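(* Let $EP \in e\mathcal{MPGN}4$. Suppose $EP$ contains three pairwise adjacent vertices $a,b,c$, each of degree $5$, together with six further distinct vertices $d,v_1,v_2,v_3,v_4,v_5$ such that the neighbourhoods are $N(a)=\{b,c,d,v_1,v_2\}$, $N(b)=\{a,c,d,v_4,v_5\}$, $N(c)=\{a,b,v_2,v_3,v_4\}$ (so that $d$-$v_1$-$v_2$-$v_3$-$v_4$-$v_5$-$d$ is the cycle of neighbours surrounding the triangle $abc$). Then it is impossible that $\deg(v_1)=5$ and $\deg(d)=6$; that is, $EP$ contains no such configuration with $\deg(a)=\deg(b)=\deg(c)=\deg(v_1)=5$ and $\deg(d)=6$.
   Context: All graphs are simple and connected. A maximal planar graph (MPG) is a planar graph to which no edge joining two nonadjacent vertices can be added while keeping it planar (equivalently, for at least 3 vertices, a plane graph all of whose faces are triangles). Let $\mathcal{N}4$ be the set of all simple connected planar graphs that are not 4-colorable (in the usual proper vertex-coloring sense). Then $e\mathcal{MPGN}4$ denotes the set of graphs $EP\in\mathcal{N}4$ that are maximal planar graphs and have the minimum possible number of vertices among graphs in $\mathcal{N}4$ (i.e., minimal counterexamples to the Four Color Theorem that are MPGs). $\deg(x)$ denotes the degree of vertex $x$ and $N(x)$ its set of neighbours. *)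

theory Defs
  imports "HOL-Analysis.Analysis"
begin

definition simple_graph :: "'a set \<Rightarrow> ('a \<Rightarrow> 'a \<Rightarrow> bool) \<Rightarrow> bool" where
  "simple_graph V E \<longleftrightarrow> finite V \<and> (\<forall>u v. E u v \<longrightarrow> u \<in> V \<and> v \<in> V \<and> u \<noteq> v)
      \<and> (\<forall>u v. E u v \<longrightarrow> E v u)"

definition connected_graph :: "'a set \<Rightarrow> ('a \<Rightarrow> 'a \<Rightarrow> bool) \<Rightarrow> bool" where
  "connected_graph V E \<longleftrightarrow> V \<noteq> {} \<and> (\<forall>u\<in>V. \<forall>v\<in>V. E\<^sup>*\<^sup>* u v)"

definition nbrs :: "('a \<Rightarrow> 'a \<Rightarrow> bool) \<Rightarrow> 'a \<Rightarrow> 'a set" where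
  "nbrs E x = {y. E x y}"

definition deg :: "('a \<Rightarrow> 'a \<Rightarrow> bool) \<Rightarrow> 'a \<Rightarrow> nat" where
  "deg E x = card (nbrs E x)"

definition edge_set :: "('a \<Rightarrow> 'a \<Rightarrow> bool) \<Rightarrow> 'a set set" where
  "edge_set E = {{u, v} | u v. E u v}"

definition planar :: "'a set \<Rightarrow> ('a \<Rightarrow> 'a \<Rightarrow> bool) \<Rightarrow> bool" where
  "planar V E \<longleftrightarrow> (\<exists>(f :: 'a \<Rightarrow> complex) (g :: 'a set \<Rightarrow> real \<Rightarrow> complex).
      inj_on f V \<and>
      (\<forall>u v. E u v \<longrightarrow> arc (g {u, v}) \<and>
          {pathstart (g {u, v}), pathfinish (g {u, v})} = {f u, f v} \<and>
          path_image (g {u, v}) \<inter> f ` V = {f u, f v}) \<and>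
      (\<forall>e1\<in>edge_set E. \<forall>e2\<in>edge_set E. e1 \<noteq> e2 \<longrightarrow>
          path_image (g e1) \<inter> path_image (g e2) \<subseteq> f ` (e1 \<inter> e2)))"

definition add_edge :: "('a \<Rightarrow> 'a \<Rightarrow> bool) \<Rightarrow> 'a \<Rightarrow> 'a \<Rightarrow> ('a \<Rightarrow> 'a \<Rightarrow> bool)" where
  "add_edge E u v = (\<lambda>x y. E x y \<or> (x = u \<and> y = v) \<or> (x = v \<and> y = u))"

definition maximal_planar :: "'a set \<Rightarrow> ('a \<Rightarrow> 'a \<Rightarrow> bool) \<Rightarrow> bool" where
  "maximal_planar V E \<longleftrightarrow> planar V E \<and>
     (\<forall>u\<in>V. \<forall>v\<in>V. u \<noteq> v \<and> \<not> E u v \<longrightarrow> \<not> planar V (add_edge E u v))"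

definition colorable :: "nat \<Rightarrow> 'a set \<Rightarrow> ('a \<Rightarrow> 'a \<Rightarrow> bool) \<Rightarrow> bool" where
  "colorable k V E \<longleftrightarrow> (\<exists>c :: 'a \<Rightarrow> nat. (\<forall>v\<in>V. c v < k) \<and> (\<forall>u v. E u v \<longrightarrow> c u \<noteq> c v))"

definition N4 :: "'a set \<Rightarrow> ('a \<Rightarrow> 'a \<Rightarrow> bool) \<Rightarrow> bool" where
  "N4 V E \<longleftrightarrow> simple_graph V E \<and> connected_graph V E \<and> planar V E \<and> \<not> colorable 4 V E"

text \<open>Minimality is measured against all graphs in N4; every finite graph is isomorphic
  to one on natural-number vertices, so we compare against those.\<close>

definition eMPGN4 :: "'a set \<Rightarrow> ('a \<Rightarrow> 'a \<Rightarrow> bool) \<Rightarrow> bool" where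
  "eMPGN4 V E \<longleftrightarrow> N4 V E \<and> maximal_planar V E \<and>
     (\<forall>(V' :: nat set) E'. N4 V' E' \<longrightarrow> card V \<le> card V')"

end

theory Submission
  imports Defs "HOL-Complex_Analysis.Complex_Analysis"
begin

text \<open>
  Collapsing an edge of a plane drawing to a point, which the Riemann mapping theorem makes
  possible, shows that contracting connected vertex sets preserves planarity, while a Jordan curve
  argument shows that the complete graph on five vertices is not planar. Hence the minimal
  counterexample has no K5 minor, and every proper contraction of it has a proper 4-colouring. These
  two facts give the cyclic structure around the vertices of degree 5, and thereby the ring
  y, z, v2, c, v4, v5, x of the neighbours of the four vertices a, b, d, v1. They also give that two
  disjoint chains outside the configuration cannot join interlaced pairs of ring vertices.

  A 4-colouring of the graph in which {a, b, d, v2, y} has been contracted yields, up to renaming of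
  the colours, one of 18 colourings of the ring. Fourteen of them extend to a, b, d, v1, and the other
  four are led by at most four rounds of Kempe interchanges to an extendable one.
\<close>

section \<open>Collapsing an arc\<close>

text \<open>\<open>planar\<close> supplies arcs in the complex plane but no faces, rotations or
  Euler formula, so no cyclic order around a vertex can be read off. In its place stand two local
  facts. A vertex of degree 5 cannot have three pairwise nonadjacent neighbours: contracted with
  them, it would see at most three colours. And a K4 would yield a K5 minor, a separating clique or
  a graph that four colours suffice for. Together they recover the edges around a, b, c and v1.

  Contracting an edge would normally require redrawing the arcs near it. Instead one continuous map
  of the plane, zero exactly on that arc and injective elsewhere, carries the whole drawing at once.

  The set {a, b, d, v2, y} is chosen because each of z, c, v4, v5, x has a neighbour in it: the
  common colour of y and v2 occurs nowhere else on the ring, which is what keeps the list of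
  patterns short.\<close>

text \<open>The inversion \<open>w = 1 / (z - p)\<close> moves the end \<open>p\<close> to infinity
  and infinity to 0, so \<open>U\<close> is the image of the sphere minus the arc. Its complement is
  closed, connected and unbounded, and an open connected plane set whose complement has no bounded
  component is simply connected.\<close>

lemma arc_inversion_simply_connected:
  fixes \<gamma> :: "real \<Rightarrow> complex"
  assumes "arc \<gamma>" and p: "p = pathstart \<gamma>"
  defines "U \<equiv> {w. w \<noteq> 0 \<longrightarrow> p + 1 / w \<notin> path_image \<gamma>}"
  shows "open U" "simply_connected U"
proof -
  let ?I = "path_image \<gamma>" and ?r = "\<lambda>z. 1 / (z - p)"
  let ?C = "?r ` (?I - {p})"
  have UC: "- U = ?C"
  proof (intro set_eqI iffI)
    fix w assume "w \<in> - U"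
    then have w: "w \<noteq> 0" "p + 1 / w \<in> ?I" by (auto simp: U_def)
    then have "?r (p + 1 / w) = w" "p + 1 / w \<noteq> p" by auto
    with w show "w \<in> ?C" by (metis DiffI image_eqI singletonD)
  qed (auto simp: U_def)
  have pI: "p \<in> ?I" by (simp add: p pathstart_in_path_image)
  have "bounded ?I" using assms bounded_arc_image by blast
  then obtain B where B: "B > 0" "\<And>z. z \<in> ?I \<Longrightarrow> norm z \<le> B" by (meson bounded_pos)
  \<comment> \<open>Points of the arc are within \<open>2 * B\<close> of \<open>p\<close>, so their
    images stay away from 0, the only point where \<open>p + 1 / w\<close> is discontinuous in
    \<open>w\<close>. This makes \<open>?C\<close> closed.\<close>
  have far: "1 / (2 * B) \<le> norm w" if w: "w \<in> ?C" for w
  proof -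
    obtain z where z: "z \<in> ?I" "z \<noteq> p" "w = 1 / (z - p)" using w by auto
    have "norm (z - p) \<le> 2 * B" using B(2)[OF z(1)] B(2)[OF pI] norm_triangle_ineq4[of z p] by linarith
    then show ?thesis using z by (simp add: norm_divide frac_le)
  qed
  have "?C = {w. norm w \<ge> 1 / (2 * B)} \<inter> (\<lambda>w. p + 1 / w) -` ?I"
  proof (intro set_eqI iffI)
    fix w assume "w \<in> {w. norm w \<ge> 1 / (2 * B)} \<inter> (\<lambda>w. p + 1 / w) -` ?I"
    then have "w \<noteq> 0" "p + 1 / w \<in> ?I" using B(1) by (auto dest: divide_pos_pos)
    then show "w \<in> ?C" using UC by (auto simp: U_def)
  next
    fix w assume "w \<in> ?C"
    moreover from this have "w \<in> - U" by (simp add: UC)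
    ultimately show "w \<in> {w. norm w \<ge> 1 / (2 * B)} \<inter> (\<lambda>w. p + 1 / w) -` ?I"
      using far by (auto simp: U_def)
  qed
  moreover have "closed ({w::complex. norm w \<ge> 1 / (2 * B)} \<inter> (\<lambda>w. p + 1 / w) -` ?I)"
  proof (rule continuous_closed_preimage)
    show "continuous_on {w::complex. norm w \<ge> 1 / (2 * B)} (\<lambda>w. p + 1 / w)"
      using B(1) by (intro continuous_intros) (auto dest: divide_pos_pos)
    show "closed {w::complex. norm w \<ge> 1 / (2 * B)}"
      by (intro closed_Collect_le continuous_intros)
    show "closed ?I" using assms closed_arc_image by blast
  qed
  ultimately have "closed ?C" by simp
  then show "open U" by (simp only: open_closed UC)
  have I_eq: "?I - {p} = \<gamma> ` {0<..1}"
  proof -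
    have "{0..1} = insert 0 {0<..(1::real)}" by auto
    moreover have "\<gamma> t \<noteq> \<gamma> 0" if t: "t \<in> {0<..1}" for t
      using assms(1) t inj_onD[of \<gamma> "{0..1}" t 0] unfolding arc_def by auto
    ultimately show ?thesis unfolding p path_image_def pathstart_def by auto
  qed
  have "connected (\<gamma> ` {0<..1})"
    using assms(1) unfolding arc_def path_def
    by (intro connected_continuous_image) (auto intro: continuous_on_subset)
  then have "connected ?C" unfolding I_eq[symmetric]
    by (intro connected_continuous_image continuous_intros) auto
  have g: "\<gamma> 0 = p" using p by (simp add: pathstart_def)
  \<comment> \<open>Points of the arc close to its start \<open>p\<close> are sent arbitrarily far
    out.\<close>
  have "\<not> bounded ?C"
  proof
    assume "bounded ?C"
    then obtain M where M: "M > 0" "\<And>w. w \<in> ?C \<Longrightarrow> norm w \<le> M" by (meson bounded_pos)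
    have "continuous (at 0 within {0..1}) \<gamma>"
      using assms(1) unfolding arc_def path_def by (simp add: continuous_on_eq_continuous_within)
    then obtain e where e: "e > 0" "\<And>t. t \<in> {0..1} \<Longrightarrow> dist t 0 < e \<Longrightarrow> dist (\<gamma> t) p < 1 / (2 * M)"
      using M(1) g unfolding continuous_within_eps_delta by (metis divide_pos_pos mult_pos_pos zero_less_numeral zero_less_one)
    define t where "t = min 1 (e / 2)"
    have t: "t \<in> {0<..1}" "dist t 0 < e" using e(1) by (auto simp: t_def)
    then have "norm (\<gamma> t - p) < 1 / (2 * M)" using e(2)[of t] by (auto simp: dist_norm)
    moreover have gt: "\<gamma> t \<in> ?I - {p}" using t I_eq by auto
    ultimately have "2 * M < norm (1 / (\<gamma> t - p))"
      using M(1) by (simp add: norm_divide field_simps)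
    moreover have "norm (1 / (\<gamma> t - p)) \<le> M" using M(2) gt by blast
    ultimately show False using M(1) by linarith
  qed
  have "components (- U) = {?C}"
    unfolding UC using \<open>connected ?C\<close> \<open>\<not> bounded ?C\<close>
    by (metis bounded_empty components_eq_sing_iff)
  \<comment> \<open>\<open>U\<close> without 0 is the image of the complement of the arc, which is
    connected; 0, the image of infinity, is a limit point of it.\<close>
  moreover have "connected U"
  proof -
    have "connected (- ?I)" using assms(1) by (simp add: connected_arc_complement)
    then have c1: "connected (?r ` (- ?I))"
      by (rule connected_continuous_image[rotated]) (use pI in \<open>auto intro!: continuous_intros\<close>)
    have eq: "?r ` (- ?I) = U - {0}"
    proof (intro set_eqI iffI)
      fix w assume w: "w \<in> U - {0}"
      then have "p + 1 / w \<in> - ?I" "w = ?r (p + 1 / w)" by (auto simp: U_def)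
      then show "w \<in> ?r ` (- ?I)" by blast
    next
      fix w assume "w \<in> ?r ` (- ?I)"
      then obtain z where z: "z \<notin> ?I" "w = ?r z" by auto
      then have "z \<noteq> p" using pI by auto
      with z show "w \<in> U - {0}" by (auto simp: U_def)
    qed
    have "0 \<in> U" by (simp add: U_def)
    then have "0 islimpt U" using \<open>open U\<close> by (simp add: interior_limit_point interior_open)
    then have "0 \<in> closure (U - {0})" by (simp add: islimpt_in_closure)
    then have "U \<subseteq> closure (U - {0})" using closure_subset[of "U - {0}"] by blast
    then show ?thesis
      using connected_intermediate_closure[of "U - {0}" U] c1 unfolding eq by blast
  qed
  ultimately show "simply_connected U"
    using \<open>\<not> bounded ?C\<close> unfolding simply_connected_eq_unbounded_complement_components[OF \<open>open U\<close>] by simp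
qed

text \<open>Moore's theorem for a single arc: after moving one end of the arc to infinity, the
  complement is simply connected, hence homeomorphic to the plane.\<close>

lemma arc_collapse:
  fixes \<gamma> :: "real \<Rightarrow> complex"
  assumes "arc \<gamma>"
  shows "\<exists>\<Phi> :: complex \<Rightarrow> complex. continuous_on UNIV \<Phi> \<and>
    (\<forall>z. \<Phi> z = 0 \<longleftrightarrow> z \<in> path_image \<gamma>) \<and> inj_on \<Phi> (- path_image \<gamma>)"
proof -
  define p where "p = pathstart \<gamma>"
  let ?I = "path_image \<gamma>" and ?r = "\<lambda>z. 1 / (z - p)"
  define U where "U = {w. w \<noteq> 0 \<longrightarrow> p + 1 / w \<notin> path_image \<gamma>}"
  have oU: "open U" and scU: "simply_connected U"
    using arc_inversion_simply_connected[OF assms p_def] by (auto simp: U_def)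
  have U0: "0 \<in> U" by (simp add: U_def)
  have pI: "p \<in> ?I" by (simp add: p_def pathstart_in_path_image)
  have clI: "closed ?I" using assms closed_arc_image by blast
  have "U homeomorphic (UNIV::complex set)"
    using scU oU U0 by (metis emptyE homeomorphic_ball01_UNIV homeomorphic_trans simply_connected_eq_homeomorphic_to_disc)
  then obtain \<psi> \<psi>' where hom: "homeomorphism U (UNIV::complex set) \<psi> \<psi>'" by (auto simp: homeomorphic_def)
  have rU: "?r z \<in> U" "?r z \<noteq> 0" if "z \<notin> ?I" for z
    using that pI by (auto simp: U_def)
  have inj: "\<psi> w = \<psi> w' \<longleftrightarrow> w = w'" if "w \<in> U" "w' \<in> U" for w w'
    using hom that by (metis homeomorphism_apply1)
  have psi': "\<psi>' w \<in> U" "\<psi> (\<psi>' w) = w" for w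
    using hom by (auto simp: homeomorphism_def)
  \<comment> \<open>A second inversion sends \<open>\<psi> 0\<close>, which stands for infinity,
    back to infinity. Near the arc \<open>\<psi>\<close> tends to infinity, so the arc collapses to
    0.\<close>
  define \<Phi> where "\<Phi> = (\<lambda>z. if z \<in> ?I then 0 else 1 / (\<psi> (?r z) - \<psi> 0))"
  have ne: "\<psi> (?r z) - \<psi> 0 \<noteq> 0" if "z \<notin> ?I" for z
    using inj[OF rU(1)[OF that] U0] rU(2)[OF that] by auto
  have zero: "\<Phi> z = 0 \<longleftrightarrow> z \<in> ?I" for z
    using ne by (auto simp: \<Phi>_def)
  have injo: "inj_on \<Phi> (- ?I)"
  proof (rule inj_onI)
    fix x y assume xy: "x \<in> - ?I" "y \<in> - ?I" "\<Phi> x = \<Phi> y"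
    then have "1 / (\<psi> (?r x) - \<psi> 0) = 1 / (\<psi> (?r y) - \<psi> 0)" by (simp add: \<Phi>_def)
    then have "\<psi> (?r x) = \<psi> (?r y)" by simp
    then have "?r x = ?r y" using inj rU xy by auto
    then show "x = y" using xy pI by (auto simp: divide_simps split: if_splits)
  qed
  have "continuous_on (- ?I) \<Phi>"
  proof -
    have r: "continuous_on (- ?I) ?r" using pI by (auto intro!: continuous_intros)
    have "continuous_on U \<psi>" using hom by (simp add: homeomorphism_def)
    then have "continuous_on (- ?I) (\<lambda>z. \<psi> (?r z))"
      by (rule continuous_on_compose2[OF _ r]) (use rU in auto)
    then have "continuous_on (- ?I) (\<lambda>z. 1 / (\<psi> (?r z) - \<psi> 0))"
      using ne by (intro continuous_intros) auto
    then show ?thesis by (rule continuous_on_eq) (auto simp: \<Phi>_def)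
  qed
  then have off: "isCont \<Phi> z" if "z \<notin> ?I" for z
    using clI that by (simp add: continuous_on_eq_continuous_at open_Compl)
  have on: "isCont \<Phi> z" if z: "z \<in> ?I" for z
    unfolding continuous_at_eps_delta
  proof (intro allI impI)
    fix e :: real assume e: "e > 0"
    \<comment> \<open>\<open>K\<close> holds the points where the second inversion is not yet
      smaller than \<open>e\<close>. As \<open>x\<close> nears the arc, \<open>1 / (x - p)\<close>
      leaves \<open>K\<close>: near \<open>p\<close> because \<open>K\<close> is bounded, elsewhere
      because \<open>K\<close> is closed and contained in \<open>U\<close>.\<close>
    define K where "K = \<psi>' ` cball (\<psi> 0) (1 / e)"
    have "continuous_on UNIV \<psi>'" using hom by (simp add: homeomorphism_def)
    then have cK: "compact K" unfolding K_def
      by (meson compact_cball compact_continuous_image continuous_on_subset subset_UNIV)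
    have KU: "K \<subseteq> U" using psi' by (auto simp: K_def)
    have "\<exists>d>0. \<forall>x. x \<notin> ?I \<longrightarrow> dist x z < d \<longrightarrow> ?r x \<notin> K"
    proof (cases "z = p")
      case True
      obtain M where M: "M > 0" "\<And>w. w \<in> K \<Longrightarrow> norm w \<le> M" using cK by (meson bounded_pos compact_imp_bounded)
      have "?r x \<notin> K" if "x \<notin> ?I" "dist x z < 1 / M" for x
      proof
        assume "?r x \<in> K"
        then have "norm (?r x) \<le> M" by (rule M)
        moreover have "x \<noteq> p" using that pI by auto
        ultimately show False using that(2) M(1) True by (simp add: norm_divide dist_norm field_simps)
      qed
      then show ?thesis using M(1) by (intro exI[of _ "1 / M"]) auto
    next
      case False
      have "isCont ?r z" using False by (intro continuous_intros) auto
      have "?r z \<notin> U" using False z by (simp add: U_def)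
      then have "?r z \<in> - K" using KU by auto
      moreover have "open (- K)" using cK by (simp add: compact_imp_closed open_Compl)
      ultimately obtain e' where "e' > 0" "\<And>w. dist w (?r z) < e' \<Longrightarrow> w \<in> - K"
        by (meson open_dist)
      moreover obtain d where "d > 0" "\<And>x. dist x z < d \<Longrightarrow> dist (?r x) (?r z) < e'"
        using \<open>isCont ?r z\<close> \<open>e' > 0\<close> unfolding continuous_at_eps_delta by blast
      ultimately show ?thesis by blast
    qed
    then obtain d where d: "d > 0" "\<And>x. x \<notin> ?I \<Longrightarrow> dist x z < d \<Longrightarrow> ?r x \<notin> K" by blast
    have "dist (\<Phi> x) (\<Phi> z) < e" if "dist x z < d" for x
    proof (cases "x \<in> ?I")
      case True then show ?thesis using z e by (simp add: \<Phi>_def)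
    next
      case False
      have "\<psi> (?r x) \<notin> cball (\<psi> 0) (1 / e)"
        using d(2)[OF False that] rU[OF False] hom unfolding K_def homeomorphism_def
        by (metis image_eqI)
      then have "1 / e < norm (\<psi> (?r x) - \<psi> 0)" by (simp add: dist_norm norm_minus_commute)
      then have "norm (1 / (\<psi> (?r x) - \<psi> 0)) < e"
        using e ne[OF False] by (simp add: norm_divide field_simps)
      then show ?thesis using False z by (simp add: \<Phi>_def)
    qed
    then show "\<exists>d>0. \<forall>x'. dist x' z < d \<longrightarrow> dist (\<Phi> x') (\<Phi> z) < e" using d(1) by blast
  qed
  have cont: "continuous_on UNIV \<Phi>" using on off continuous_at_imp_continuous_on by blast
  show ?thesis using cont zero injo by (intro exI[of _ \<Phi>]) simp
qed

section \<open>Minors of planar graphs\<close>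

text \<open>With connected fibres this is a contraction, with an injective map a mere renaming of
  vertices. Loops are dropped and parallel edges merge.\<close>

definition quot :: "('a \<Rightarrow> 'a \<Rightarrow> bool) \<Rightarrow> ('a \<Rightarrow> 'b) \<Rightarrow> 'b \<Rightarrow> 'b \<Rightarrow> bool" where
  "quot E \<pi> p q \<longleftrightarrow> p \<noteq> q \<and> (\<exists>x y. E x y \<and> \<pi> x = p \<and> \<pi> y = q)"

definition induced :: "('a \<Rightarrow> 'a \<Rightarrow> bool) \<Rightarrow> 'a set \<Rightarrow> 'a \<Rightarrow> 'a \<Rightarrow> bool" where
  "induced E S x y \<longleftrightarrow> E x y \<and> x \<in> S \<and> y \<in> S"

text \<open>The empty set counts as connected, which admits fibres over values that are not
  attained.\<close>

definition conn_on :: "('a \<Rightarrow> 'a \<Rightarrow> bool) \<Rightarrow> 'a set \<Rightarrow> bool" where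
  "conn_on E S \<longleftrightarrow> (\<forall>x\<in>S. \<forall>y\<in>S. (induced E S)\<^sup>*\<^sup>* x y)"

lemma simple_graphD:
  assumes "simple_graph V E"
  shows "finite V" "E u v \<Longrightarrow> u \<in> V" "E u v \<Longrightarrow> v \<in> V" "E u v \<Longrightarrow> u \<noteq> v" "E u v \<Longrightarrow> E v u" "\<not> E u u"
  using assms unfolding simple_graph_def by blast+

lemma simple_graph_quot: "simple_graph V E \<Longrightarrow> simple_graph (\<pi> ` V) (quot E \<pi>)"
  unfolding simple_graph_def quot_def by blast

lemma simple_graph_induced: "simple_graph V E \<Longrightarrow> S \<subseteq> V \<Longrightarrow> simple_graph S (induced E S)"
  unfolding simple_graph_def induced_def by (auto intro: finite_subset)

text \<open>The body of \<open>planar\<close> with its two witnesses exposed, so that a drawing can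
  be carried along by a map of the plane.\<close>

definition drawing ::
  "'a set \<Rightarrow> ('a \<Rightarrow> 'a \<Rightarrow> bool) \<Rightarrow> ('a \<Rightarrow> complex) \<Rightarrow> ('a set \<Rightarrow> real \<Rightarrow> complex) \<Rightarrow> bool" where
  "drawing V E f g \<longleftrightarrow> inj_on f V \<and>
      (\<forall>u v. E u v \<longrightarrow> arc (g {u, v}) \<and>
          {pathstart (g {u, v}), pathfinish (g {u, v})} = {f u, f v} \<and>
          path_image (g {u, v}) \<inter> f ` V = {f u, f v}) \<and>
      (\<forall>e1\<in>edge_set E. \<forall>e2\<in>edge_set E. e1 \<noteq> e2 \<longrightarrow>
          path_image (g e1) \<inter> path_image (g e2) \<subseteq> f ` (e1 \<inter> e2))"

lemma planar_iff_drawing: "planar V E \<longleftrightarrow> (\<exists>f g. drawing V E f g)"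
  unfolding planar_def drawing_def ..

lemma drawingI:
  assumes "inj_on f V" "\<And>u v. E u v \<Longrightarrow> arc (g {u, v})"
    "\<And>u v. E u v \<Longrightarrow> {pathstart (g {u, v}), pathfinish (g {u, v})} = {f u, f v}"
    "\<And>u v. E u v \<Longrightarrow> path_image (g {u, v}) \<inter> f ` V = {f u, f v}"
    "\<And>e1 e2. e1 \<in> edge_set E \<Longrightarrow> e2 \<in> edge_set E \<Longrightarrow> e1 \<noteq> e2 \<Longrightarrow>
       path_image (g e1) \<inter> path_image (g e2) \<subseteq> f ` (e1 \<inter> e2)"
  shows "drawing V E f g"
  using assms unfolding drawing_def by blast

lemma drawingD:
  assumes "drawing V E f g"
  shows "inj_on f V" "E u v \<Longrightarrow> arc (g {u, v})"
    "E u v \<Longrightarrow> {pathstart (g {u, v}), pathfinish (g {u, v})} = {f u, f v}"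
    "E u v \<Longrightarrow> path_image (g {u, v}) \<inter> f ` V = {f u, f v}"
    "e1 \<in> edge_set E \<Longrightarrow> e2 \<in> edge_set E \<Longrightarrow> e1 \<noteq> e2 \<Longrightarrow>
       path_image (g e1) \<inter> path_image (g e2) \<subseteq> f ` (e1 \<inter> e2)"
  using assms unfolding drawing_def by blast+

lemma planar_subgraph:
  assumes "planar V E" "V' \<subseteq> V" and E': "\<And>u v. E' u v \<Longrightarrow> E u v \<and> u \<in> V' \<and> v \<in> V'"
  shows "planar V' E'"
proof -
  obtain f g where dr: "drawing V E f g" using assms(1) by (auto simp: planar_iff_drawing)
  note fg = drawingD[OF dr]
  have "edge_set E' \<subseteq> edge_set E" using E' by (auto simp: edge_set_def)
  moreover have "path_image (g {u, v}) \<inter> f ` V' = {f u, f v}" if "E' u v" for u v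
  proof -
    have E: "E u v" "u \<in> V'" "v \<in> V'" using E'[OF that] by auto
    have "P \<inter> A = S" if "P \<inter> B = S" "S \<subseteq> A" "A \<subseteq> B" for P A B S :: "complex set" using that by blast
    from this[OF fg(4)[OF E(1)]] E(2,3) assms(2) show ?thesis by (simp add: image_mono)
  qed
  ultimately have "drawing V' E' f g"
    using fg(2,3,5) E' inj_on_subset[OF fg(1) assms(2)] by (intro drawingI) (meson subsetD)+
  then show ?thesis by (auto simp: planar_iff_drawing)
qed

lemma planar_relabel:
  assumes "simple_graph V E" "planar V E" "inj_on \<pi> V"
  shows "planar (\<pi> ` V) (quot E \<pi>)"
proof -
  note sg = simple_graphD[OF assms(1)]
  obtain f g where dr: "drawing V E f g" using assms(2) by (auto simp: planar_iff_drawing)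
  note fg = drawingD[OF dr]
  define \<iota> where "\<iota> = inv_into V \<pi>"
  have \<iota>: "\<iota> (\<pi> x) = x" if "x \<in> V" for x using assms(3) that by (simp add: \<iota>_def)
  have edge: "\<exists>e\<in>edge_set E. e \<subseteq> V \<and> e' = \<pi> ` e \<and> \<iota> ` e' = e" if e': "e' \<in> edge_set (quot E \<pi>)" for e'
  proof -
    obtain x y where xy: "e' = {\<pi> x, \<pi> y}" "E x y" using e' by (auto simp: edge_set_def quot_def)
    moreover have "x \<in> V" "y \<in> V" using sg xy(2) by auto
    moreover from this have "\<iota> ` e' = {x, y}" using xy(1) \<iota> by simp
    ultimately show ?thesis by (intro bexI[of _ "{x, y}"]) (auto simp: edge_set_def)
  qed
  have "drawing (\<pi> ` V) (quot E \<pi>) (f \<circ> \<iota>) (\<lambda>e. g (\<iota> ` e))"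
  proof (rule drawingI)
    show "inj_on (f \<circ> \<iota>) (\<pi> ` V)" using fg(1) \<iota> by (auto simp: inj_on_def)
    have im: "(f \<circ> \<iota>) ` \<pi> ` V = f ` V" using \<iota> by force
    fix p q assume "quot E \<pi> p q"
    then obtain x y where xy: "p = \<pi> x" "q = \<pi> y" "E x y" by (auto simp: quot_def)
    then have i: "\<iota> p = x" "\<iota> q = y" using \<iota> sg by auto
    show "arc (g (\<iota> ` {p, q}))"
      "{pathstart (g (\<iota> ` {p, q})), pathfinish (g (\<iota> ` {p, q}))} = {(f \<circ> \<iota>) p, (f \<circ> \<iota>) q}"
      "path_image (g (\<iota> ` {p, q})) \<inter> (f \<circ> \<iota>) ` \<pi> ` V = {(f \<circ> \<iota>) p, (f \<circ> \<iota>) q}"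
      unfolding im using fg(2-4)[OF xy(3)] i by auto
  next
    fix e1 e2 assume e: "e1 \<in> edge_set (quot E \<pi>)" "e2 \<in> edge_set (quot E \<pi>)" "e1 \<noteq> e2"
    obtain d1 where d1: "d1 \<in> edge_set E" "d1 \<subseteq> V" "e1 = \<pi> ` d1" "\<iota> ` e1 = d1"
      using edge[OF e(1)] by auto
    obtain d2 where d2: "d2 \<in> edge_set E" "d2 \<subseteq> V" "e2 = \<pi> ` d2" "\<iota> ` e2 = d2"
      using edge[OF e(2)] by auto
    have "d1 \<noteq> d2" using e(3) d1(3) d2(3) by auto
    then have "path_image (g d1) \<inter> path_image (g d2) \<subseteq> f ` (d1 \<inter> d2)"
      by (rule fg(5)[OF d1(1) d2(1)])
    moreover have "\<iota> ` (e1 \<inter> e2) = d1 \<inter> d2"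
    proof -
      have "e1 \<inter> e2 = \<pi> ` (d1 \<inter> d2)"
        unfolding d1(3) d2(3) using inj_on_image_Int[OF assms(3) d1(2) d2(2)] by simp
      then show ?thesis unfolding image_comp[symmetric] \<iota>_def
        using inv_into_image_cancel[OF assms(3), of "d1 \<inter> d2"] d1(2) by (simp add: le_infI1)
    qed
    ultimately show "path_image (g (\<iota> ` e1)) \<inter> path_image (g (\<iota> ` e2)) \<subseteq> (f \<circ> \<iota>) ` (e1 \<inter> e2)"
      by (simp only: d1(4) d2(4) image_comp[symmetric])
  qed
  then show ?thesis by (auto simp: planar_iff_drawing)
qed

text \<open>Compose the drawing with the map that collapses the arc of \<open>{u, v}\<close> to 0.
  Every other edge touches that arc in at most one point, a common end, so its image is again an
  arc, and different edges still meet only in common ends.\<close>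

lemma planar_contract_edge:
  assumes "simple_graph V E" "planar V E" "E u v"
  shows "planar (id(v := u) ` V) (quot E (id(v := u)))"
proof -
  note sg = simple_graphD[OF assms(1)]
  obtain f g where dr: "drawing V E f g" using assms(2) by (auto simp: planar_iff_drawing)
  note fg = drawingD[OF dr]
  define \<rho> where "\<rho> = id(v := u)"
  let ?I = "path_image (g {u, v})"
  have uvV: "u \<in> V" "v \<in> V" "u \<noteq> v" using sg assms(3) by auto
  obtain \<Phi> :: "complex \<Rightarrow> complex" where \<Phi>: "continuous_on UNIV \<Phi>"
    "\<And>z. \<Phi> z = 0 \<longleftrightarrow> z \<in> ?I" "inj_on \<Phi> (- ?I)"
    using arc_collapse[OF fg(2)[OF assms(3)]] by blast
  have uvI: "f u \<in> ?I" "f v \<in> ?I" using fg(4)[OF assms(3)] by auto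
  have fVI: "f x \<in> ?I \<longleftrightarrow> x \<in> {u, v}" if "x \<in> V" for x
  proof
    assume "f x \<in> ?I"
    then have "f x \<in> {f u, f v}" using fg(4)[OF assms(3)] that by blast
    then show "x \<in> {u, v}" using fg(1) that uvV by (auto simp: inj_on_def)
  qed (use uvI in auto)
  have \<Phi>\<rho>: "\<Phi> (f (\<rho> x)) = \<Phi> (f x)" for x
  proof -
    have "\<Phi> (f u) = 0" "\<Phi> (f v) = 0" using uvI \<Phi>(2) by auto
    then show ?thesis by (simp add: \<rho>_def)
  qed
  have \<Phi>eq: "x = y" if "\<Phi> x = \<Phi> y" "x \<notin> ?I" for x y
  proof -
    have "y \<notin> ?I" using \<Phi>(2) that by metis
    then show ?thesis using inj_onD[OF \<Phi>(3) that(1)] that(2) by simp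
  qed
  \<comment> \<open>A common neighbour of \<open>u\<close> and \<open>v\<close> yields two edges
    with the same image; one of them is chosen, and only its arc is drawn.\<close>
  define s where "s = (\<lambda>e'. SOME e. e \<in> edge_set E \<and> \<rho> ` e = e')"
  let ?E = "quot E \<rho>"
  have s: "s e' \<in> edge_set E" "\<rho> ` s e' = e'" if e': "e' \<in> edge_set ?E" for e'
  proof -
    obtain x y where "E x y" "e' = {\<rho> x, \<rho> y}"
      using e' by (auto simp: edge_set_def quot_def)
    then have "\<exists>e. e \<in> edge_set E \<and> \<rho> ` e = e'"
      by (intro exI[of _ "{x, y}"]) (auto simp: edge_set_def)
    then show "s e' \<in> edge_set E" "\<rho> ` s e' = e'" unfolding s_def by (metis (mono_tags, lifting) someI_ex)+
  qed
  have eg: "arc (g e) \<and> {pathstart (g e), pathfinish (g e)} = f ` e \<and> path_image (g e) \<inter> f ` V = f ` e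
      \<and> e \<subseteq> V \<and> (\<exists>x y. x \<noteq> y \<and> e = {x, y})"
    if "e \<in> edge_set E" for e
  proof -
    obtain x y where xy: "e = {x, y}" "E x y" using \<open>e \<in> edge_set E\<close> by (auto simp: edge_set_def)
    have "x \<noteq> y" "x \<in> V" "y \<in> V" using sg xy(2) by auto
    then show ?thesis using fg(2-4)[OF xy(2)] xy(1) by auto
  qed
  have sI: "path_image (g (s e')) \<inter> ?I \<subseteq> f ` (s e' \<inter> {u, v})" "s e' \<noteq> {u, v}" if "e' \<in> edge_set ?E" for e'
  proof -
    have "card e' = 2" using that by (auto simp: edge_set_def quot_def card_2_iff)
    moreover have "\<rho> ` {u, v} = {u}" by (auto simp: \<rho>_def)
    ultimately show "s e' \<noteq> {u, v}" using s(2)[OF that] by auto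
    then show "path_image (g (s e')) \<inter> ?I \<subseteq> f ` (s e' \<inter> {u, v})"
      using fg(5)[OF s(1)[OF that], of "{u, v}"] assms(3) by (auto simp: edge_set_def)
  qed
  have one: "\<exists>t. path_image (g (s e')) \<inter> ?I \<subseteq> {t}" if e: "e' \<in> edge_set ?E" for e'
  proof -
    obtain x y where xy: "x \<noteq> y" "s e' = {x, y}" using eg[OF s(1)[OF e]] by auto
    then have "\<exists>t. s e' \<inter> {u, v} \<subseteq> {t}" using sI(2)[OF e] by auto
    then show ?thesis using sI(1)[OF e] by blast
  qed
  have injs: "inj_on \<Phi> (path_image (g (s e')))" if e: "e' \<in> edge_set ?E" for e'
  proof (rule inj_onI)
    fix x y assume xy: "x \<in> path_image (g (s e'))" "y \<in> path_image (g (s e'))" "\<Phi> x = \<Phi> y"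
    show "x = y"
    proof (cases "x \<in> ?I")
      case True
      then have "y \<in> ?I" using xy \<Phi>(2) by metis
      with True xy one[OF e] show ?thesis by blast
    qed (use xy \<Phi>eq in auto)
  qed
  have "drawing (\<rho> ` V) ?E (\<Phi> \<circ> f) (\<lambda>e. \<Phi> \<circ> g (s e))"
  proof (rule drawingI)
    show "inj_on (\<Phi> \<circ> f) (\<rho> ` V)"
    proof (rule inj_onI)
      fix p q assume pq: "p \<in> \<rho> ` V" "q \<in> \<rho> ` V" "(\<Phi> \<circ> f) p = (\<Phi> \<circ> f) q"
      then have V: "p \<in> V" "q \<in> V" "p \<noteq> v" "q \<noteq> v" using uvV by (auto simp: \<rho>_def split: if_splits)
      show "p = q"
      proof (cases "p = u")
        case True
        then have "f q \<in> ?I" using pq(3) uvI \<Phi>(2) by (metis comp_apply)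
        then show ?thesis using fVI V True by auto
      next
        case False
        then have "f p = f q" using pq(3) fVI[OF V(1)] V \<Phi>eq by auto
        then show ?thesis using fg(1) V by (auto simp: inj_on_def)
      qed
    qed
  next
    fix p q assume pq: "?E p q"
    then have e: "{p, q} \<in> edge_set ?E" by (auto simp: edge_set_def)
    note G = eg[OF s(1)[OF e]]
    have cont: "continuous_on (path_image (g (s {p, q}))) \<Phi>" using \<Phi>(1) continuous_on_subset by blast
    show "arc (\<Phi> \<circ> g (s {p, q}))"
      using G injs[OF e] path_continuous_image[OF _ cont]
      unfolding arc_def path_image_def by (blast intro: comp_inj_on)
    have im: "\<Phi> ` f ` (s {p, q}) = {(\<Phi> \<circ> f) p, (\<Phi> \<circ> f) q}"
    proof -
      have "\<Phi> ` f ` (s {p, q}) = \<Phi> ` f ` (\<rho> ` s {p, q})" using \<Phi>\<rho> by (auto simp: image_iff)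
      then show ?thesis using s(2)[OF e] by simp
    qed
    show st: "{pathstart (\<Phi> \<circ> g (s {p, q})), pathfinish (\<Phi> \<circ> g (s {p, q}))} = {(\<Phi> \<circ> f) p, (\<Phi> \<circ> f) q}"
    proof -
      have "{pathstart (\<Phi> \<circ> h), pathfinish (\<Phi> \<circ> h)} = \<Phi> ` {pathstart h, pathfinish h}" for h
        by (simp add: pathstart_compose pathfinish_compose)
      moreover have "{pathstart (g (s {p, q})), pathfinish (g (s {p, q}))} = f ` s {p, q}" using G by blast
      ultimately show ?thesis using im by metis
    qed
    show "path_image (\<Phi> \<circ> g (s {p, q})) \<inter> (\<Phi> \<circ> f) ` \<rho> ` V = {(\<Phi> \<circ> f) p, (\<Phi> \<circ> f) q}"
    proof
      have "p \<in> \<rho> ` V" "q \<in> \<rho> ` V" using pq sg by (auto simp: quot_def)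
      then have "{(\<Phi> \<circ> f) p, (\<Phi> \<circ> f) q} \<subseteq> (\<Phi> \<circ> f) ` \<rho> ` V" by blast
      moreover have "{(\<Phi> \<circ> f) p, (\<Phi> \<circ> f) q} \<subseteq> path_image (\<Phi> \<circ> g (s {p, q}))"
        unfolding st[symmetric] by (simp only: insert_subset empty_subsetI pathstart_in_path_image pathfinish_in_path_image simp_thms)
      ultimately show "{(\<Phi> \<circ> f) p, (\<Phi> \<circ> f) q} \<subseteq> path_image (\<Phi> \<circ> g (s {p, q})) \<inter> (\<Phi> \<circ> f) ` \<rho> ` V"
        by (rule Int_greatest[rotated])
    next
      have on: "\<Phi> z \<in> \<Phi> ` f ` (s {p, q})"
        if z: "z \<in> path_image (g (s {p, q}))" "\<Phi> z = \<Phi> (f w)" "w \<in> \<rho> ` V" for z w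
      proof (cases "z \<in> ?I")
        case True
        then show ?thesis using sI(1)[OF e] z(1) by blast
      next
        case False
        have "w \<in> V" using z(3) uvV by (auto simp: \<rho>_def split: if_splits)
        moreover have "z = f w" using \<Phi>eq False z(2) by blast
        ultimately have "z \<in> f ` s {p, q}" using G z(1) by blast
        then show ?thesis by blast
      qed
      show "path_image (\<Phi> \<circ> g (s {p, q})) \<inter> (\<Phi> \<circ> f) ` \<rho> ` V \<subseteq> {(\<Phi> \<circ> f) p, (\<Phi> \<circ> f) q}"
        unfolding im[symmetric] path_image_compose
      proof
        fix t assume "t \<in> \<Phi> ` path_image (g (s {p, q})) \<inter> (\<Phi> \<circ> f) ` \<rho> ` V"
        then obtain z w where "t = \<Phi> z" "z \<in> path_image (g (s {p, q}))" "w \<in> \<rho> ` V" "t = \<Phi> (f w)"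
          unfolding image_comp[symmetric] by (elim IntE imageE) blast
        then show "t \<in> \<Phi> ` f ` s {p, q}" using on[of z w] by simp
      qed
    qed
  next
    fix e1 e2 assume e: "e1 \<in> edge_set ?E" "e2 \<in> edge_set ?E" "e1 \<noteq> e2"
    \<comment> \<open>If the common image point is 0, both edges end in the merged vertex; otherwise
      \<open>\<Phi>\<close> is injective there and the original arcs already met in that
      point.\<close>
    have on: "\<Phi> z1 \<in> \<Phi> ` f ` (e1 \<inter> e2)"
      if z: "z1 \<in> path_image (g (s e1))" "z2 \<in> path_image (g (s e2))" "\<Phi> z1 = \<Phi> z2" for z1 z2
    proof (cases "z1 \<in> ?I")
      case True
      then have "z2 \<in> ?I" using z(3) \<Phi>(2) by metis
      have "z1 \<in> f ` (s e1 \<inter> {u, v})" "z2 \<in> f ` (s e2 \<inter> {u, v})"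
        using sI(1)[OF e(1)] sI(1)[OF e(2)] True z(1,2) \<open>z2 \<in> ?I\<close> by blast+
      then have "s e1 \<inter> {u, v} \<noteq> {}" "s e2 \<inter> {u, v} \<noteq> {}" by auto
      moreover have "\<rho> t = u" if "t \<in> {u, v}" for t using that by (auto simp: \<rho>_def)
      ultimately have "u \<in> \<rho> ` s e1" "u \<in> \<rho> ` s e2" by (metis IntE equals0I imageI)+
      then have "u \<in> e1 \<inter> e2" using s(2) e by auto
      moreover have "\<Phi> z1 = \<Phi> (f u)" using True uvI \<Phi>(2) by metis
      ultimately show ?thesis by blast
    next
      case False
      then have "z1 = z2" using \<Phi>eq z(3) by blast
      moreover have "s e1 \<noteq> s e2" using e s(2) by metis
      ultimately obtain t where t: "z1 = f t" "t \<in> s e1" "t \<in> s e2"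
        using fg(5)[OF s(1)[OF e(1)] s(1)[OF e(2)]] z by blast
      then have "\<rho> t \<in> e1 \<inter> e2" using s(2) e by blast
      then show ?thesis using t(1) \<Phi>\<rho> by (metis imageI)
    qed
    show "path_image (\<Phi> \<circ> g (s e1)) \<inter> path_image (\<Phi> \<circ> g (s e2)) \<subseteq> (\<Phi> \<circ> f) ` (e1 \<inter> e2)"
      unfolding path_image_compose image_comp[symmetric]
    proof
      fix t assume "t \<in> \<Phi> ` path_image (g (s e1)) \<inter> \<Phi> ` path_image (g (s e2))"
      then obtain z1 z2 where "t = \<Phi> z1" "z1 \<in> path_image (g (s e1))" "z2 \<in> path_image (g (s e2))" "t = \<Phi> z2"
        by blast
      then show "t \<in> \<Phi> ` f ` (e1 \<inter> e2)" using on[of z1 z2] by simp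
    qed
  qed
  then show ?thesis unfolding \<rho>_def by (auto simp: planar_iff_drawing)
qed

lemma rtranclp_induced_edge:
  assumes "(induced E S)\<^sup>*\<^sup>* x y" "x \<noteq> y"
  shows "\<exists>z. E x z \<and> x \<in> S \<and> z \<in> S"
  using assms(1)
proof (cases rule: converse_rtranclpE)
  case base
  then show ?thesis using assms(2) by simp
next
  case (step z)
  then show ?thesis by (auto simp: induced_def)
qed

text \<open>Contract one edge inside a fibre with several vertices and induct on the number of
  vertices: fibres stay connected and the quotient does not change. When no such fibre is left, the
  map only renames vertices.\<close>

theorem planar_quotient:
  assumes "simple_graph V E" "planar V E" "\<And>p. conn_on E {x \<in> V. \<pi> x = p}"
  shows "planar (\<pi> ` V) (quot E \<pi>)"
  using assms
proof (induction "card V" arbitrary: V E rule: less_induct)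
  case less
  note sg = simple_graphD[OF less.prems(1)]
  show ?case
  proof (cases "inj_on \<pi> V")
    case True
    then show ?thesis using planar_relabel less.prems by blast
  next
    case False
    then obtain x y where xy: "x \<in> V" "y \<in> V" "x \<noteq> y" "\<pi> x = \<pi> y" by (auto simp: inj_on_def)
    then have "(induced E {z \<in> V. \<pi> z = \<pi> x})\<^sup>*\<^sup>* x y"
      using less.prems(3)[of "\<pi> x"] unfolding conn_on_def by auto
    then obtain v where v: "E x v" "\<pi> v = \<pi> x" using rtranclp_induced_edge[OF _ xy(3)] by fastforce
    define \<rho> where "\<rho> = id(v := x)"
    let ?V = "\<rho> ` V" and ?E = "quot E \<rho>"
    have V: "?V = V - {v}" using v sg by (auto simp: \<rho>_def)
    have \<pi>\<rho>: "\<pi> (\<rho> z) = \<pi> z" for z using v by (simp add: \<rho>_def)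
    have "card ?V < card V" unfolding V using v sg by (meson card_Diff1_less)
    moreover have "simple_graph ?V ?E" by (rule simple_graph_quot[OF less.prems(1)])
    moreover have "planar ?V ?E" unfolding \<rho>_def by (rule planar_contract_edge[OF less.prems(1,2) v(1)])
    moreover have "conn_on ?E {z \<in> ?V. \<pi> z = p}" for p
      unfolding conn_on_def
    proof (intro ballI)
      let ?S = "{z \<in> V. \<pi> z = p}" and ?T = "{z \<in> ?V. \<pi> z = p}"
      fix a b assume ab: "a \<in> ?T" "b \<in> ?T"
      have walk: "(induced ?E ?T)\<^sup>*\<^sup>* (\<rho> a) (\<rho> b)" if "(induced E ?S)\<^sup>*\<^sup>* a b" for a b
        using that
      proof (induction rule: rtranclp_induct)
        case (step y z)
        have "\<rho> y = \<rho> z \<or> induced ?E ?T (\<rho> y) (\<rho> z)"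
          using step(2) \<pi>\<rho> by (auto simp: induced_def quot_def)
        then show ?case
        proof
          assume "\<rho> y = \<rho> z"
          then show ?thesis using step(3) by simp
        next
          assume "induced ?E ?T (\<rho> y) (\<rho> z)"
          then show ?thesis by (rule rtranclp.rtrancl_into_rtrancl[OF step(3)])
        qed
      qed auto
      have "(induced E ?S)\<^sup>*\<^sup>* a b"
        using less.prems(3)[of p] ab V unfolding conn_on_def by auto
      moreover have "\<rho> a = a" "\<rho> b = b" using ab unfolding V by (auto simp: \<rho>_def)
      ultimately show "(induced ?E ?T)\<^sup>*\<^sup>* a b" using walk[of a b] by simp
    qed
    ultimately have "planar (\<pi> ` ?V) (quot ?E \<pi>)" using less.hyps by blast
    moreover have "\<pi> ` ?V = \<pi> ` V" using \<pi>\<rho> by (auto simp: image_iff)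
    moreover have "quot ?E \<pi> = quot E \<pi>"
    proof (intro ext iffI)
      fix p q assume "quot E \<pi> p q"
      then obtain x y where "p \<noteq> q" "E x y" "\<pi> x = p" "\<pi> y = q" by (auto simp: quot_def)
      moreover from this have "?E (\<rho> x) (\<rho> y)" using \<pi>\<rho>[of x] \<pi>\<rho>[of y] by (auto simp: quot_def)
      ultimately show "quot ?E \<pi> p q" using \<pi>\<rho> unfolding quot_def[of ?E] by blast
    next
      fix p q assume "quot ?E \<pi> p q"
      then obtain x y where "p \<noteq> q" "?E x y" "\<pi> x = p" "\<pi> y = q" by (auto simp: quot_def[of ?E])
      moreover from this obtain x' y' where "E x' y'" "\<rho> x' = x" "\<rho> y' = y" by (auto simp: quot_def)
      ultimately have "\<pi> x' = p" "\<pi> y' = q" using \<pi>\<rho>[of x'] \<pi>\<rho>[of y'] by auto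
      with \<open>p \<noteq> q\<close> \<open>E x' y'\<close> show "quot E \<pi> p q" by (auto simp: quot_def)
    qed
    ultimately show ?thesis by simp
  qed
qed

section \<open>Crossing arcs\<close>

lemma connected_subset_open:
  assumes "connected S" "open U" "open W" "U \<inter> W = {}" "S \<subseteq> U \<union> W" "S \<inter> U \<noteq> {}"
  shows "S \<subseteq> U"
  using connectedD[OF assms(1-3)] assms(4-6) by blast

text \<open>The cross-cut \<open>A\<close> splits the inside of the closed curve into a region
  bounded by \<open>c1\<close> and \<open>A\<close> and one bounded by \<open>c2\<close> and
  \<open>A\<close>. The interior of \<open>B\<close> avoids \<open>A\<close>, so it stays in one of
  them and both ends of \<open>B\<close> lie in the closure of that region; but \<open>p\<close> is
  off \<open>c2\<close> and \<open>q\<close> is off \<open>c1\<close>.\<close>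

lemma crossing_arcs_inside:
  fixes c1 c2 A B :: "real \<Rightarrow> complex"
  assumes c1: "arc c1" "pathstart c1 = a" "pathfinish c1 = b"
    and c2: "arc c2" "pathstart c2 = a" "pathfinish c2 = b"
    and A: "arc A" "pathstart A = a" "pathfinish A = b"
    and B: "arc B" "pathstart B = p" "pathfinish B = q"
    and ab: "a \<noteq> b"
    and int: "path_image c1 \<inter> path_image c2 = {a, b}" "path_image c1 \<inter> path_image A = {a, b}"
      "path_image c2 \<inter> path_image A = {a, b}"
    and Bint: "path_image B \<inter> (path_image c1 \<union> path_image c2) = {p, q}" "path_image A \<inter> path_image B = {}"
    and p: "p \<notin> path_image c2" and q: "q \<notin> path_image c1"
    and A_in: "path_image A \<inter> inside (path_image c1 \<union> path_image c2) \<noteq> {}"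
    and B_in: "path_image B \<inter> inside (path_image c1 \<union> path_image c2) \<noteq> {}"
  shows False
proof -
  let ?J = "path_image c1 \<union> path_image c2"
  let ?I1 = "inside (path_image c1 \<union> path_image A)" and ?I2 = "inside (path_image c2 \<union> path_image A)"
  have "?I1 \<inter> ?I2 = {} \<and> ?I1 \<union> ?I2 \<union> (path_image A - {a, b}) = inside ?J"
    by (rule split_inside_simple_closed_curve[OF arc_imp_simple_path[OF c1(1)] c1(2,3)
        arc_imp_simple_path[OF c2(1)] c2(2,3) arc_imp_simple_path[OF A(1)] A(2,3) ab int A_in]) (rule conjI)
  then have disj: "?I1 \<inter> ?I2 = {}" and un: "?I1 \<union> ?I2 \<union> (path_image A - {a, b}) = inside ?J"
    by (fact conjunct1, fact conjunct2)
  have clos: "closed (path_image c1)" "closed (path_image c2)" "closed (path_image A)"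
    using c1 c2 A closed_arc_image by blast+
  let ?B = "path_image B - {p, q}"
  have endless: "?B = B ` {0<..<1}"
    using simple_path_endless[OF arc_imp_simple_path[OF B(1)]] B by simp
  have conB: "connected ?B"
    using connected_simple_path_endless[OF arc_imp_simple_path[OF B(1)]] B by simp
  have "continuous_on (closure {0<..<1}) B" using B(1) by (simp add: arc_def path_def)
  then have "B ` closure {0<..<1} \<subseteq> closure (B ` {0<..<1})"
    by (intro image_closure_subset) (auto simp: closure_subset)
  moreover have "p = B 0" "q = B 1" using B by (auto simp: pathstart_def pathfinish_def)
  ultimately have pq: "p \<in> closure ?B" "q \<in> closure ?B" unfolding endless by auto
  have pqJ: "p \<in> ?J" "q \<in> ?J" using Bint by blast+
  have J_in: "?J \<inter> inside ?J = {}" using inside_no_overlap[of ?J] by blast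
  have BJ: "?B \<inter> ?J = {}" using Bint by blast
  have B_meets: "?B \<inter> inside ?J \<noteq> {}" using B_in pqJ J_in by blast
  have opn: "open (inside ?J)" "open (outside ?J)" "open ?I1" "open ?I2"
    using clos by (simp_all add: open_inside open_outside closed_Un)
  have "?B \<subseteq> inside ?J \<union> outside ?J" using BJ inside_Un_outside[of ?J] by blast
  then have "?B \<subseteq> inside ?J"
    by (rule connected_subset_open[OF conB opn(1,2) inside_Int_outside _ B_meets])
  then have sub: "?B \<subseteq> ?I1 \<union> ?I2" using un Bint(2) by blast
  have side: "?B \<subseteq> ?I1 \<or> ?B \<subseteq> ?I2"
    using connectedD[OF conB opn(3,4)] sub disj by blast
  have cl: "closure ?I1 \<subseteq> path_image c1 \<union> path_image A \<union> ?I1" "closure ?I2 \<subseteq> path_image c2 \<union> path_image A \<union> ?I2"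
    using clos by (simp_all add: closure_inside_subset closed_Un)
  have pqA: "p \<notin> path_image A" "q \<notin> path_image A" using Bint by blast+
  show False using side
  proof
    assume "?B \<subseteq> ?I1"
    then have "q \<in> closure ?I1" using pq closure_mono by blast
    then have "q \<in> ?I1" using cl q pqA by blast
    then show False using un J_in pqJ by blast
  next
    assume "?B \<subseteq> ?I2"
    then have "p \<in> closure ?I2" using pq closure_mono by blast
    then have "p \<in> ?I2" using cl p pqA by blast
    then show False using un J_in pqJ by blast
  qed
qed

text \<open>If one outside point failed, connectedness would put the image of the whole outside into
  the outside of the image curve. The punctured inside goes there as well, because its image is
  unbounded. The new inside could then contain only 0, yet it is open and nonempty.\<close>

lemma inversion_outside_inside:
  fixes c :: "real \<Rightarrow> complex"
  assumes c: "simple_path c" "pathfinish c = pathstart c"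
    and z0: "z0 \<in> inside (path_image c)" and z: "z \<in> outside (path_image c)"
  shows "1 / (z - z0) \<in> inside ((\<lambda>w. 1 / (w - z0)) ` path_image c)"
proof (rule ccontr)
  let ?r = "\<lambda>w. 1 / (w - z0)" and ?J = "path_image c"
  let ?J' = "?r ` ?J"
  have r_inj: "?r x = ?r y \<longleftrightarrow> x = y" if "x \<noteq> z0" "y \<noteq> z0" for x y
    using that by (auto simp: field_simps)
  have J: "inside ?J \<union> outside ?J = - ?J" "inside ?J \<inter> outside ?J = {}" "open (inside ?J)"
    "connected (inside ?J)" "connected (outside ?J)"
    using Jordan_inside_outside[OF c] by auto
  have oJ: "z0 \<notin> ?J" "z0 \<notin> outside ?J" using z0 J by blast+
  have cont: "continuous_on S ?r" if "z0 \<notin> S" for S using that by (intro continuous_intros) auto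
  have path: "simple_path (?r \<circ> c)"
  proof -
    have "path (?r \<circ> c)" using c(1) oJ by (intro path_continuous_image cont) (auto simp: simple_path_def)
    moreover have "?r (c s) = ?r (c t) \<longleftrightarrow> c s = c t" if "s \<in> {0..1}" "t \<in> {0..1}" for s t
      using that oJ(1) by (intro r_inj) (auto simp: path_image_def)
    ultimately show ?thesis using c(1) unfolding simple_path_def loop_free_def by simp
  qed
  have clp: "pathfinish (?r \<circ> c) = pathstart (?r \<circ> c)" using c(2) by (simp add: pathfinish_compose pathstart_compose)
  have J': "inside ?J' \<union> outside ?J' = - ?J'" "inside ?J' \<inter> outside ?J' = {}" "open (inside ?J')"
    "open (outside ?J')" "inside ?J' \<noteq> {}" "bounded (inside ?J')"
    using Jordan_inside_outside[OF path clp] by (simp_all add: path_image_compose)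
  have side: "S \<subseteq> inside ?J' \<or> S \<subseteq> outside ?J'" if "connected S" "S \<inter> ?J' = {}" for S
    using connectedD[OF that(1) J'(3,4)] J'(1,2) that(2) by blast
  have r_off: "?r ` S \<inter> ?J' = {}" if "S \<inter> ?J = {}" "z0 \<notin> S" for S
    using that oJ(1) r_inj by (fastforce simp: image_iff)
  assume "?r z \<notin> inside ?J'"
  then have "\<not> ?r ` outside ?J \<subseteq> inside ?J'" using z by blast
  moreover have "connected (?r ` outside ?J)" using J(5) cont[OF oJ(2)] by (rule connected_continuous_image[rotated])
  moreover have "outside ?J \<inter> ?J = {}" using J by blast
  ultimately have out: "?r ` outside ?J \<subseteq> outside ?J'" using side r_off oJ(2) by meson
  have "connected (inside ?J - {z0})" using connected_open_delete[OF J(3,4)] by simp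
  then have con: "connected (?r ` (inside ?J - {z0}))" using cont[of "inside ?J - {z0}"]
    by (intro connected_continuous_image) auto
  have "\<not> bounded (?r ` (inside ?J - {z0}))"
  proof
    assume "bounded (?r ` (inside ?J - {z0}))"
    then obtain M where M: "M > 0" "\<And>w. w \<in> inside ?J - {z0} \<Longrightarrow> norm (?r w) \<le> M"
      unfolding bounded_pos by blast
    obtain e where e: "e > 0" "ball z0 e \<subseteq> inside ?J" using J(3) z0 by (meson openE)
    define d where "d = min (e / 2) (1 / (2 * M))"
    have d: "d > 0" "d < e" "d \<le> 1 / (2 * M)" using e(1) M(1) by (auto simp: d_def)
    have "z0 + of_real d \<in> inside ?J - {z0}" using e d by (auto simp: dist_norm)
    then have "norm (1 / complex_of_real d) \<le> M" using M(2) by force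
    then show False using d M(1) by (simp add: norm_divide field_simps)
  qed
  then have "\<not> ?r ` (inside ?J - {z0}) \<subseteq> inside ?J'" using J'(6) bounded_subset by blast
  moreover have "?r ` (inside ?J - {z0}) \<inter> ?J' = {}" using r_off[of "inside ?J - {z0}"] J(1) by blast
  ultimately have "?r ` (inside ?J - {z0}) \<subseteq> outside ?J'" using side con by blast
  have "inside ?J' \<subseteq> {0}"
  proof
    fix w assume w: "w \<in> inside ?J'"
    show "w \<in> {0}"
    proof (rule ccontr)
      assume "w \<notin> {0}"
      then have w_eq: "?r (z0 + 1 / w) = w" and "z0 + 1 / w \<noteq> z0" by auto
      moreover have "z0 + 1 / w \<in> ?J \<or> z0 + 1 / w \<in> inside ?J \<or> z0 + 1 / w \<in> outside ?J" using J(1) by blast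
      ultimately have "?r (z0 + 1 / w) \<in> ?J' \<or> ?r (z0 + 1 / w) \<in> outside ?J'"
        using out \<open>?r ` (inside ?J - {z0}) \<subseteq> outside ?J'\<close> by blast
      then have "w \<in> ?J' \<or> w \<in> outside ?J'" unfolding w_eq .
      then show False using w J'(1,2) by blast
    qed
  qed
  then have "inside ?J' = {0}" using J'(5) by blast
  then show False using J'(3) not_open_singleton by metis
qed

text \<open>The outside case reduces to the inside one by an inversion about a point
  \<open>z0\<close> inside the closed curve.\<close>

lemma crossing_arcs:
  fixes c1 c2 A B :: "real \<Rightarrow> complex"
  assumes c1: "arc c1" "pathstart c1 = a" "pathfinish c1 = b"
    and c2: "arc c2" "pathstart c2 = a" "pathfinish c2 = b"
    and A: "arc A" "pathstart A = a" "pathfinish A = b"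
    and B: "arc B" "pathstart B = p" "pathfinish B = q"
    and ab: "a \<noteq> b"
    and int: "path_image c1 \<inter> path_image c2 = {a, b}" "path_image c1 \<inter> path_image A = {a, b}"
      "path_image c2 \<inter> path_image A = {a, b}"
    and Bint: "path_image B \<inter> (path_image c1 \<union> path_image c2) = {p, q}" "path_image A \<inter> path_image B = {}"
    and p: "p \<notin> path_image c2" and q: "q \<notin> path_image c1"
    and S: "S = inside (path_image c1 \<union> path_image c2) \<or> S = outside (path_image c1 \<union> path_image c2)"
    and A_in: "path_image A \<inter> S \<noteq> {}" and B_in: "path_image B \<inter> S \<noteq> {}"
  shows False
  using S
proof
  let ?J = "path_image c1 \<union> path_image c2"
  assume "S = inside ?J"
  then show False using assms crossing_arcs_inside by metis
next
  let ?J = "path_image c1 \<union> path_image c2"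
  assume S: "S = outside ?J"
  let ?c = "c1 +++ reversepath c2"
  have c: "simple_path ?c" "pathfinish ?c = pathstart ?c" "path_image ?c = ?J"
    using c1 c2 int(1) by (auto simp: path_image_join intro!: simple_path_join_loop arc_reversepath)
  note Jord = Jordan_inside_outside[OF c(1,2), unfolded c(3)]
  then obtain z0 where z0: "z0 \<in> inside ?J" by auto
  let ?r = "\<lambda>w. 1 / (w - z0)"
  have to_in: "?r z \<in> inside (?r ` ?J)" if "z \<in> S" for z
    using inversion_outside_inside[OF c(1,2), unfolded c(3), OF z0] that S by blast
  have oJ: "z0 \<notin> ?J" using z0 Jord by blast
  \<comment> \<open>An arc that meets the outside and touches the curve only in its ends cannot pass
    through \<open>z0\<close>, so the inversion is continuous on it.\<close>
  have off: "z0 \<notin> path_image X"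
    if X: "arc X" "path_image X \<inter> S \<noteq> {}" "path_image X \<inter> ?J = {pathstart X, pathfinish X}" for X
  proof
    assume o': "z0 \<in> path_image X"
    let ?X = "path_image X - {pathstart X, pathfinish X}"
    have "connected ?X" using connected_simple_path_endless[OF arc_imp_simple_path[OF X(1)]] .
    moreover have "z0 \<in> ?X" using o' X(3) oJ by blast
    moreover have "?X \<inter> outside ?J \<noteq> {}"
      using X(2,3) S outside_no_overlap[of ?J] by blast
    moreover have "?X \<subseteq> inside ?J \<union> outside ?J" using X(3) inside_Un_outside[of ?J] by blast
    moreover have "open (inside ?J)" "open (outside ?J)" "inside ?J \<inter> outside ?J = {}" using Jord by auto
    ultimately show False using connectedD[of ?X "inside ?J" "outside ?J"] z0 by blast
  qed
  have "path_image A \<inter> ?J = {a, b}" using int(2,3) by blast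
  then have oX: "z0 \<notin> path_image c1" "z0 \<notin> path_image c2" "z0 \<notin> path_image A" "z0 \<notin> path_image B"
    using oJ off[OF A(1) A_in] off[OF B(1) B_in] A B Bint(1) by auto
  have inj: "inj_on ?r (- {z0})" by (auto simp: inj_on_def field_simps)
  have arcs: "arc (?r \<circ> X)" if "arc X" "z0 \<notin> path_image X" for X
  proof -
    have "path (?r \<circ> X)" using that by (intro path_continuous_image continuous_intros) (auto simp: arc_def)
    moreover have "inj_on ?r (X ` {0..1})" using that inj by (auto simp: path_image_def intro: inj_on_subset)
    ultimately show ?thesis using that(1) by (auto simp: arc_def intro: comp_inj_on)
  qed
  have Int: "?r ` X \<inter> ?r ` Y = ?r ` (X \<inter> Y)" if "z0 \<notin> X" "z0 \<notin> Y" for X Y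
    using inj_on_image_Int[OF inj, of X Y] that by blast
  have mem: "?r x \<notin> ?r ` X" if "z0 \<notin> X" "x \<noteq> z0" "x \<notin> X" for x X
    using that inj by (auto simp: inj_on_def)
  have ne: "a \<noteq> z0" "b \<noteq> z0" "p \<noteq> z0" "q \<noteq> z0"
    using oX c1 B by (auto simp: pathstart_in_path_image pathfinish_in_path_image)
  show False
  proof (rule crossing_arcs_inside[of "?r \<circ> c1" "?r a" "?r b" "?r \<circ> c2" "?r \<circ> A" "?r \<circ> B" "?r p" "?r q"])
    show "?r a \<noteq> ?r b" using ab ne by auto
    show "path_image (?r \<circ> A) \<inter> inside (path_image (?r \<circ> c1) \<union> path_image (?r \<circ> c2)) \<noteq> {}"
      "path_image (?r \<circ> B) \<inter> inside (path_image (?r \<circ> c1) \<union> path_image (?r \<circ> c2)) \<noteq> {}"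
      using A_in B_in to_in by (auto simp: path_image_compose image_Un[symmetric])
    show "path_image (?r \<circ> B) \<inter> (path_image (?r \<circ> c1) \<union> path_image (?r \<circ> c2)) = {?r p, ?r q}"
      using Int[of "path_image B" ?J] oX Bint(1) by (simp add: path_image_compose image_Un)
  qed (use assms oX ne in \<open>simp_all add: arcs path_image_compose Int mem pathstart_compose pathfinish_compose\<close>)
qed

section \<open>The complete graph on five vertices\<close>

text \<open>Edges are unordered sets, so a drawing does not fix the direction of an arc; joining
  arcs to longer paths requires one.\<close>

lemma oriented_arc:
  assumes "drawing V E f g" "E u v"
  shows "\<exists>h. arc h \<and> pathstart h = f u \<and> pathfinish h = f v \<and> path_image h = path_image (g {u, v})"
proof -
  have a: "arc (g {u, v})" and e: "{pathstart (g {u, v}), pathfinish (g {u, v})} = {f u, f v}"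
    using drawingD[OF assms(1)] assms(2) by auto
  consider "pathstart (g {u, v}) = f u" "pathfinish (g {u, v}) = f v"
    | "pathstart (g {u, v}) = f v" "pathfinish (g {u, v}) = f u"
    using e by (auto simp: doubleton_eq_iff)
  then show ?thesis
  proof cases
    case 1
    with a show ?thesis by blast
  next
    case 2
    with a show ?thesis by (intro exI[of _ "reversepath (g {u, v})"]) (simp add: arc_reversepath)
  qed
qed

text \<open>Take the closed curve v0 v1 v2 v3. On the side that contains v4, each diagonal would
  cross the path through v4 that joins the other two corners. So both diagonals run on the opposite
  side, where they cross each other.\<close>

lemma K5_not_planar:
  assumes sg: "simple_graph V E" and pl: "planar V E"
    and dist: "distinct [v0, v1, v2, v3, v4]"
    and K: "\<And>x y. x \<in> {v0, v1, v2, v3, v4} \<Longrightarrow> y \<in> {v0, v1, v2, v3, v4} \<Longrightarrow> x \<noteq> y \<Longrightarrow> E x y"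
  shows False
proof -
  let ?W = "{v0, v1, v2, v3, v4}"
  obtain f g where dr: "drawing V E f g" using pl by (auto simp: planar_iff_drawing)
  define Q where "Q = (\<lambda>x y. path_image (g {x, y}))"
  have ends: "f x \<in> Q x y" "f y \<in> Q x y" if "x \<in> ?W" "y \<in> ?W" "x \<noteq> y" for x y
    using drawingD(4)[OF dr K[OF that]] unfolding Q_def by blast+
  have edge: "{x, y} \<in> edge_set E" if "x \<in> ?W" "y \<in> ?W" "x \<noteq> y" for x y
    using K[OF that] unfolding edge_set_def by blast
  have sym: "Q x y = Q y x" for x y by (simp add: Q_def insert_commute)
  have I1: "Q x y \<inter> Q x z = {f x}" if "x \<in> ?W" "y \<in> ?W" "z \<in> ?W" "x \<noteq> y" "x \<noteq> z" "y \<noteq> z" for x y z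
  proof -
    have ne: "{x, y} \<noteq> {x, z}" and int: "{x, y} \<inter> {x, z} = {x}" using that by (auto simp: doubleton_eq_iff)
    have "Q x y \<inter> Q x z \<subseteq> {f x}"
      using drawingD(5)[OF dr edge[OF that(1,2,4)] edge[OF that(1,3,5)] ne]
      unfolding Q_def int image_insert image_empty .
    then show ?thesis using ends[OF that(1,2,4)] ends[OF that(1,3,5)] by blast
  qed
  have D: "Q x y \<inter> Q z w = {}"
    if "x \<in> ?W" "y \<in> ?W" "z \<in> ?W" "w \<in> ?W" "x \<noteq> y" "z \<noteq> w" "x \<noteq> z" "x \<noteq> w" "y \<noteq> z" "y \<noteq> w" for x y z w
  proof -
    have ne: "{x, y} \<noteq> {z, w}" and int: "{x, y} \<inter> {z, w} = {}" using that by (auto simp: doubleton_eq_iff)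
    show ?thesis
      using drawingD(5)[OF dr edge[OF that(1,2,5)] edge[OF that(3,4,6)] ne]
      unfolding Q_def int image_empty subset_empty .
  qed
  have f_ne: "f x \<noteq> f y" if "x \<in> ?W" "y \<in> ?W" "x \<noteq> y" for x y
    using drawingD(1)[OF dr] simple_graphD(2,3)[OF sg K[OF that]] that(3) by (auto simp: inj_on_def)
  have nin: "f z \<notin> Q x y" if "x \<in> ?W" "y \<in> ?W" "z \<in> ?W" "x \<noteq> y" "x \<noteq> z" "y \<noteq> z" for x y z
  proof
    assume "f z \<in> Q x y"
    then have "f z \<in> {f x}" using ends(2)[OF that(1,3,5)] I1[OF that] by blast
    then show False using f_ne[OF that(1,3,5)] by simp
  qed
  define h where "h = (\<lambda>x y. SOME p. arc p \<and> pathstart p = f x \<and> pathfinish p = f y \<and> path_image p = Q x y)"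
  have h: "arc (h x y) \<and> pathstart (h x y) = f x \<and> pathfinish (h x y) = f y \<and> path_image (h x y) = Q x y"
    if "x \<in> ?W" "y \<in> ?W" "x \<noteq> y" for x y
    using someI_ex[OF oriented_arc[OF dr K[OF that]]] unfolding h_def Q_def .
  define k where "k = (\<lambda>x y z. h x y +++ h y z)"
  have k: "arc (k x y z)" "pathstart (k x y z) = f x" "pathfinish (k x y z) = f z" "path_image (k x y z) = Q x y \<union> Q y z"
    if "x \<in> ?W" "y \<in> ?W" "z \<in> ?W" "x \<noteq> y" "y \<noteq> z" "x \<noteq> z" for x y z
  proof -
    have "Q x y \<inter> Q y z = {f y}" using I1[of y x z] sym[of x y] that by simp
    then show "arc (k x y z)" "pathstart (k x y z) = f x" "pathfinish (k x y z) = f z"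
      "path_image (k x y z) = Q x y \<union> Q y z"
      using h[of x y] h[of y z] that unfolding k_def by (auto intro!: arc_join simp: path_image_join)
  qed
  have d: "v0 \<noteq> v1" "v0 \<noteq> v2" "v0 \<noteq> v3" "v0 \<noteq> v4" "v1 \<noteq> v2" "v1 \<noteq> v3" "v1 \<noteq> v4" "v2 \<noteq> v3" "v2 \<noteq> v4" "v3 \<noteq> v4"
    "v1 \<noteq> v0" "v2 \<noteq> v0" "v3 \<noteq> v0" "v4 \<noteq> v0" "v2 \<noteq> v1" "v3 \<noteq> v1" "v4 \<noteq> v1" "v3 \<noteq> v2" "v4 \<noteq> v2" "v4 \<noteq> v3"
    using dist by auto
  have I2: "Q x y \<inter> Q y z = {f y}" "Q y x \<inter> Q z y = {f y}" "Q x y \<inter> Q z y = {f y}"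
    if "x \<in> ?W" "y \<in> ?W" "z \<in> ?W" "x \<noteq> y" "y \<noteq> z" "x \<noteq> z" for x y z
    using I1[of y x z] sym[of x y] sym[of y z] that by auto
  let ?c1 = "k v0 v1 v2" and ?c2 = "k v0 v3 v2"
  let ?A = "h v0 v2" and ?B = "h v1 v3" and ?C = "k v0 v4 v2" and ?D = "k v1 v4 v3"
  \<comment> \<open>\<open>XY\<close> rules out the pair \<open>?C\<close>, \<open>?D\<close>, since
    these two paths share v4.\<close>
  have cross: False
    if X: "X = ?A \<or> X = ?C" and Y: "Y = ?B \<or> Y = ?D" and XY: "X = ?A \<or> Y = ?B"
      and S: "S = inside (path_image ?c1 \<union> path_image ?c2) \<or> S = outside (path_image ?c1 \<union> path_image ?c2)"
      and meet: "path_image X \<inter> S \<noteq> {}" "path_image Y \<inter> S \<noteq> {}"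
    for X Y S
  proof (rule crossing_arcs[of ?c1 "f v0" "f v2" ?c2 X Y "f v1" "f v3" S])
    show "f v0 \<noteq> f v2" using f_ne d by simp
    show "arc X" "pathstart X = f v0" "pathfinish X = f v2"
      using X h[of v0 v2] k[of v0 v4 v2] d by auto
    show "arc Y" "pathstart Y = f v1" "pathfinish Y = f v3"
      using Y h[of v1 v3] k[of v1 v4 v3] d by auto
    show "path_image ?c1 \<inter> path_image ?c2 = {f v0, f v2}"
      by (simp add: k d Int_Un_distrib Int_Un_distrib2 I1 I2 D insert_commute)
    show "path_image ?c1 \<inter> path_image X = {f v0, f v2}"
      using X by (elim disjE; simp add: h k d Int_Un_distrib Int_Un_distrib2 I1 I2 D insert_commute)
    show "path_image ?c2 \<inter> path_image X = {f v0, f v2}"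
      using X by (elim disjE; simp add: h k d Int_Un_distrib Int_Un_distrib2 I1 I2 D insert_commute)
    show "path_image Y \<inter> (path_image ?c1 \<union> path_image ?c2) = {f v1, f v3}"
      using Y by (elim disjE; simp add: h k d Int_Un_distrib Int_Un_distrib2 I1 I2 D insert_commute)
    show "path_image X \<inter> path_image Y = {}"
      using X Y XY by (elim disjE; simp add: h k d Int_Un_distrib Int_Un_distrib2 I1 I2 D)
    show "f v1 \<notin> path_image ?c2" "f v3 \<notin> path_image ?c1" by (simp_all add: k d nin)
  qed (use S meet k[of v0 v1 v2] k[of v0 v3 v2] d in auto)
  let ?J = "path_image ?c1 \<union> path_image ?c2"
  \<comment> \<open>An arc is infinite, whereas a diagonal meets the closed curve only in its two
    ends.\<close>
  have off: "\<not> path_image (h x y) \<subseteq> ?J" if xy: "x = v0 \<and> y = v2 \<or> x = v1 \<and> y = v3" for x y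
  proof
    assume sub: "path_image (h x y) \<subseteq> ?J"
    have "path_image (h x y) \<inter> ?J = {f x, f y}"
      using xy by (elim disjE conjE; simp add: h k d Int_Un_distrib Int_Un_distrib2 I1 I2 D insert_commute)
    with sub have "finite (path_image (h x y))" by (simp add: inf_absorb1)
    moreover have "arc (h x y)" using xy h[of v0 v2] h[of v1 v3] d by auto
    ultimately have "\<exists>t. path_image (h x y) = {t}"
      using connected_finite_iff_sing[OF connected_arc_image] by auto
    moreover have "f x \<in> path_image (h x y)" "f y \<in> path_image (h x y)" "f x \<noteq> f y"
      using xy h[of v0 v2] h[of v1 v3] ends f_ne d by auto
    ultimately show False by auto
  qed
  have sides: "path_image X \<inter> inside ?J \<noteq> {} \<or> path_image X \<inter> outside ?J \<noteq> {}"
    if "\<not> path_image X \<subseteq> ?J" for X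
    using that inside_Un_outside[of ?J] by blast
  have "f v4 \<notin> ?J" by (simp add: k d nin)
  then obtain S where S: "S = inside ?J \<or> S = outside ?J" "f v4 \<in> S"
    using inside_Un_outside[of ?J] by blast
  have CD: "path_image ?C \<inter> S \<noteq> {}" "path_image ?D \<inter> S \<noteq> {}"
    using S(2) ends[of v0 v4] ends[of v1 v4] d by (auto simp: k)
  have "path_image ?A \<inter> S = {}" using cross[of ?A ?D S] S(1) CD by blast
  moreover have "path_image ?B \<inter> S = {}" using cross[of ?C ?B S] S(1) CD by blast
  ultimately obtain T where "T = inside ?J \<or> T = outside ?J" "path_image ?A \<inter> T \<noteq> {}" "path_image ?B \<inter> T \<noteq> {}"
    using S(1) sides[of ?A] sides[of ?B] off[of v0 v2] off[of v1 v3] by blast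
  then show False using cross[of ?A ?B T] by blast
qed

section \<open>Branch sets and excluded K5 minors\<close>

definition adj :: "('a \<Rightarrow> 'a \<Rightarrow> bool) \<Rightarrow> 'a set \<Rightarrow> 'a set \<Rightarrow> bool" where
  "adj E X Y \<longleftrightarrow> (\<exists>x\<in>X. \<exists>y\<in>Y. E x y)"

lemma induced_induced: "S \<subseteq> U \<Longrightarrow> induced (induced E U) S = induced E S"
  by (auto simp: induced_def fun_eq_iff)

lemma conn_on_induced: "S \<subseteq> U \<Longrightarrow> conn_on (induced E U) S \<longleftrightarrow> conn_on E S"
  by (simp add: conn_on_def induced_induced)

text \<open>Contracting each branch set to its index turns the induced graph on their union into the
  complete graph on 0, ..., 4. \<open>sorted_wrt\<close> states each of the ten pairwise conditions
  once.\<close>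

lemma planar_no_K5_minor:
  assumes sg: "simple_graph V E" and pl: "planar V E" and len: "length Ss = 5"
    and S: "\<And>X. X \<in> set Ss \<Longrightarrow> X \<subseteq> V \<and> X \<noteq> {} \<and> conn_on E X"
    and pw: "sorted_wrt (\<lambda>X Y. X \<inter> Y = {} \<and> adj E X Y) Ss"
  shows False
proof -
  define U where "U = \<Union> (set Ss)"
  have UV: "U \<subseteq> V" using S by (auto simp: U_def)
  define \<pi> where "\<pi> = (\<lambda>x. THE i. i < 5 \<and> x \<in> Ss ! i)"
  have dj: "Ss ! i \<inter> Ss ! j = {}" if "i \<noteq> j" "i < 5" "j < 5" for i j
    using pw that len unfolding sorted_wrt_iff_nth_less by (metis Int_commute linorder_neqE_nat)
  have \<pi>: "\<pi> x = i" if "x \<in> Ss ! i" "i < 5" for x i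
    unfolding \<pi>_def using that dj by blast
  have inS: "Ss ! i \<in> set Ss" if "i < 5" for i using that len by simp
  have fib: "{x \<in> U. \<pi> x = i} = (if i < 5 then Ss ! i else {})" for i
  proof -
    have "x \<in> Ss ! \<pi> x \<and> \<pi> x < 5" if x: "x \<in> U" for x
    proof -
      obtain j where "j < 5" "x \<in> Ss ! j" using x len unfolding U_def by (metis UnionE in_set_conv_nth)
      then show ?thesis using \<pi> by auto
    qed
    moreover have "Ss ! i \<subseteq> U" if "i < 5" for i using inS[OF that] by (auto simp: U_def)
    ultimately show ?thesis using \<pi> by auto
  qed
  let ?E = "induced E U"
  have plQ: "planar (\<pi> ` U) (quot ?E \<pi>)"
  proof (rule planar_quotient)
    show sgU: "simple_graph U ?E" using simple_graph_induced[OF sg UV] .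
    show "planar U ?E" by (rule planar_subgraph[OF pl UV]) (auto simp: induced_def)
    show "conn_on ?E {x \<in> U. \<pi> x = p}" for p
    proof -
      have "conn_on E {x \<in> U. \<pi> x = p}" unfolding fib using S inS by (simp add: conn_on_def)
      then show ?thesis using conn_on_induced by (metis (no_types, lifting) mem_Collect_eq subsetI)
    qed
  qed
  have sgQ: "simple_graph (\<pi> ` U) (quot ?E \<pi>)"
    using simple_graph_quot[OF simple_graph_induced[OF sg UV]] .
  have K: "quot ?E \<pi> i j" if ij: "i < 5" "j < 5" "i \<noteq> j" for i j
  proof -
    have q: "quot ?E \<pi> i j" if "i < j" "j < 5" for i j
    proof -
      have "adj E (Ss ! i) (Ss ! j)" using pw that len unfolding sorted_wrt_iff_nth_less by simp
      then obtain x y where "x \<in> Ss ! i" "y \<in> Ss ! j" "E x y" by (auto simp: adj_def)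
      moreover have "Ss ! i \<subseteq> U" "Ss ! j \<subseteq> U" using inS[of i] inS[of j] that by (auto simp: U_def)
      ultimately show ?thesis using \<pi>[of x i] \<pi>[of y j] that unfolding quot_def induced_def by fastforce
    qed
    show ?thesis
    proof (cases "i < j")
      case False
      then have "quot ?E \<pi> j i" using q ij by simp
      then show ?thesis by (rule simple_graphD(5)[OF sgQ])
    qed (use q ij in simp)
  qed
  show False
    by (rule K5_not_planar[OF sgQ plQ, of 0 1 2 3 4]) (auto intro!: K)
qed

section \<open>Minimal counterexamples\<close>

lemma conn_onI_root:
  assumes sym: "\<And>x y. E x y \<Longrightarrow> E y x" and "\<And>x. x \<in> S \<Longrightarrow> (induced E S)\<^sup>*\<^sup>* r x"
  shows "conn_on E S"
proof -
  have "symp (induced E S)" using sym by (auto simp: symp_def induced_def)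
  then have "symp (induced E S)\<^sup>*\<^sup>*" by (rule symp_rtranclp)
  then show ?thesis unfolding conn_on_def using assms(2) by (meson rtranclp_trans sympD)
qed

lemma conn_on_singleton [simp]: "conn_on E {x}" and conn_on_empty [simp]: "conn_on E {}"
  by (simp_all add: conn_on_def)

lemma conn_on_star:
  assumes "\<And>x y. E x y \<Longrightarrow> E y x" "\<And>x. x \<in> S \<Longrightarrow> E r x"
  shows "conn_on E (insert r S)"
proof (rule conn_onI_root[where r = r])
  fix x assume "x \<in> insert r S"
  then show "(induced E (insert r S))\<^sup>*\<^sup>* r x"
    using assms(2) by (cases "x = r") (auto simp: induced_def)
qed (use assms in auto)

definition proper :: "('a \<Rightarrow> 'a \<Rightarrow> bool) \<Rightarrow> 'a set \<Rightarrow> ('a \<Rightarrow> nat) \<Rightarrow> bool" where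
  "proper E U c \<longleftrightarrow> (\<forall>x\<in>U. c x < 4) \<and> (\<forall>x\<in>U. \<forall>y\<in>U. E x y \<longrightarrow> c x \<noteq> c y)"

text \<open>\<open>small\<close> covers disconnected graphs too, since passing to an induced
  subgraph may disconnect.\<close>

locale min_noncolorable =
  fixes V :: "'a set" and E :: "'a \<Rightarrow> 'a \<Rightarrow> bool"
  assumes sg: "simple_graph V E" and pl: "planar V E" and noncol: "\<not> colorable 4 V E"
    and small: "\<And>(V' :: nat set) E'. simple_graph V' E' \<Longrightarrow> planar V' E' \<Longrightarrow> card V' < card V \<Longrightarrow> colorable 4 V' E'"
begin

lemmas sgD = simple_graphD[OF sg]

text \<open>A colouring of the contracted graph is pulled back to \<open>U\<close>. The injection
  into the natural numbers brings the quotient within reach of \<open>small\<close>.\<close>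

lemma quotient_coloring:
  fixes \<pi> :: "'a \<Rightarrow> 'b"
  assumes U: "U \<subseteq> V" and fib: "\<And>p. conn_on E {x \<in> U. \<pi> x = p}" and less: "card (\<pi> ` U) < card V"
  shows "\<exists>c. (\<forall>x\<in>U. c x < 4) \<and> (\<forall>x\<in>U. \<forall>y\<in>U. E x y \<longrightarrow> \<pi> x \<noteq> \<pi> y \<longrightarrow> c x \<noteq> c y)
    \<and> (\<forall>x\<in>U. \<forall>y\<in>U. \<pi> x = \<pi> y \<longrightarrow> c x = (c y :: nat))"
proof -
  have "finite U" using U sgD(1) finite_subset by blast
  then obtain h :: "'b \<Rightarrow> nat" where h: "inj_on h (\<pi> ` U)" using finite_imp_inj_to_nat_seg[of "\<pi> ` U"] by auto
  let ?\<pi> = "h \<circ> \<pi>" and ?E = "induced E U"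
  have sgU: "simple_graph U ?E" by (rule simple_graph_induced[OF sg U])
  have "planar (?\<pi> ` U) (quot ?E ?\<pi>)"
  proof (rule planar_quotient[OF sgU])
    show "planar U ?E" by (rule planar_subgraph[OF pl U]) (auto simp: induced_def)
    fix n show "conn_on ?E {x \<in> U. ?\<pi> x = n}"
    proof (cases "\<exists>p\<in>\<pi> ` U. h p = n")
      case True
      then obtain p where "p \<in> \<pi> ` U" "h p = n" by blast
      then have "{x \<in> U. ?\<pi> x = n} = {x \<in> U. \<pi> x = p}" using h by (auto simp: inj_on_def)
      moreover have "conn_on ?E {x \<in> U. \<pi> x = p}" using fib[of p] by (subst conn_on_induced) auto
      ultimately show ?thesis by simp
    next
      case False
      then have "{x \<in> U. ?\<pi> x = n} = {}" by auto
      then show ?thesis by (simp only: conn_on_empty)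
    qed
  qed
  moreover have "card (?\<pi> ` U) < card V" using less card_image[OF h] by (simp only: image_comp[symmetric])
  ultimately have "colorable 4 (?\<pi> ` U) (quot ?E ?\<pi>)" using small[OF simple_graph_quot[OF sgU]] by blast
  then obtain c :: "nat \<Rightarrow> nat" where c: "\<forall>v\<in>?\<pi> ` U. c v < 4" "\<forall>u v. quot ?E ?\<pi> u v \<longrightarrow> c u \<noteq> c v"
    unfolding colorable_def by blast
  have "(c \<circ> ?\<pi>) x \<noteq> (c \<circ> ?\<pi>) y" if "x \<in> U" "y \<in> U" "E x y" "\<pi> x \<noteq> \<pi> y" for x y
  proof -
    have "quot ?E ?\<pi> (?\<pi> x) (?\<pi> y)" using that inj_onD[OF h] by (auto simp: quot_def induced_def)
    then show ?thesis using c(2) by simp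
  qed
  then show ?thesis using c(1) by (intro exI[of _ "c \<circ> ?\<pi>"]) auto
qed

lemma subgraph_coloring:
  assumes "U \<subset> V"
  shows "\<exists>c. proper E U c"
proof -
  have "card U < card V" using assms sgD(1) by (rule psubset_card_mono[rotated])
  moreover have "conn_on E {x \<in> U. id x = p}" for p
  proof -
    have "{x \<in> U. id x = p} = {} \<or> {x \<in> U. id x = p} = {p}" by auto
    then show ?thesis by (metis conn_on_empty conn_on_singleton)
  qed
  ultimately show ?thesis
    using quotient_coloring[of U id] assms sgD(4) unfolding proper_def by (simp; blast)
qed

text \<open>Merging \<open>S\<close> into \<open>s\<close> loses at least the vertex
  \<open>t\<close>, so the contracted graph is small enough to be coloured.\<close>

lemma contract_coloring:
  assumes S: "S \<subseteq> U" "U \<subseteq> V" "conn_on E S" and s: "s \<in> S" "t \<in> S" "s \<noteq> t"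
  shows "\<exists>c. (\<forall>x\<in>U. c x < 4) \<and> (\<forall>x\<in>U. \<forall>y\<in>U. E x y \<longrightarrow> \<not> (x \<in> S \<and> y \<in> S) \<longrightarrow> c x \<noteq> c y)
    \<and> (\<forall>x\<in>S. c x = (c s :: nat))"
proof -
  define \<pi> where "\<pi> = (\<lambda>x. if x \<in> S then s else x)"
  have "\<pi> ` U \<subseteq> V - {t}" using S s by (auto simp: \<pi>_def)
  then have "card (\<pi> ` U) \<le> card (V - {t})" using sgD(1) by (intro card_mono) auto
  also have "\<dots> < card V" using s S sgD(1) by (meson card_Diff1_less subsetD)
  finally have "card (\<pi> ` U) < card V" .
  moreover have "conn_on E {x \<in> U. \<pi> x = p}" for p
  proof -
    have "{x \<in> U. \<pi> x = p} = S \<or> {x \<in> U. \<pi> x = p} = {p} \<or> {x \<in> U. \<pi> x = p} = {}"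
      using S s by (cases "p = s") (auto simp: \<pi>_def split: if_splits)
    then show ?thesis using S(3) by (elim disjE) (simp_all only: conn_on_empty conn_on_singleton)
  qed
  ultimately obtain c where c: "\<forall>x\<in>U. c x < 4" "\<forall>x\<in>U. \<forall>y\<in>U. E x y \<longrightarrow> \<pi> x \<noteq> \<pi> y \<longrightarrow> c x \<noteq> c y"
    "\<forall>x\<in>U. \<forall>y\<in>U. \<pi> x = \<pi> y \<longrightarrow> c x = (c y :: nat)"
    using quotient_coloring[of U \<pi>] S(2) by blast
  have ne: "\<pi> x \<noteq> \<pi> y" if "E x y" "\<not> (x \<in> S \<and> y \<in> S)" for x y
    using that s sgD(4)[OF that(1)] by (auto simp: \<pi>_def)
  have "c x = c s" if "x \<in> S" for x
  proof -
    have "\<pi> x = \<pi> s" using that s by (simp add: \<pi>_def)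
    then show ?thesis using c(3) S(1) s(1) that by blast
  qed
  then show ?thesis using c(1,2) ne by (intro exI[of _ c]) simp
qed

end

text \<open>Minimality in \<open>eMPGN4\<close> concerns connected graphs. A smaller disconnected
  graph is coloured by strong induction, separately on the part reachable from one vertex and on the
  rest, between which no edge runs.\<close>

lemma eMPGN4_min_noncolorable:
  assumes "eMPGN4 V E"
  shows "min_noncolorable V E"
proof
  show "simple_graph V E" "planar V E" "\<not> colorable 4 V E" using assms by (auto simp: eMPGN4_def N4_def)
  fix V' :: "nat set" and E'
  assume "simple_graph V' E'" "planar V' E'" "card V' < card V"
  then show "colorable 4 V' E'"
  proof (induction "card V'" arbitrary: V' E' rule: less_induct)
    case less
    note sg = simple_graphD[OF less.prems(1)]
    show ?case
    proof (cases "connected_graph V' E'")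
      case True
      then have "\<not> N4 V' E' \<Longrightarrow> ?thesis" using less.prems by (auto simp: N4_def)
      then show ?thesis using assms less.prems(3) unfolding eMPGN4_def by (meson not_less)
    next
      case False
      show ?thesis
      proof (cases "V' = {}")
        case True
        then show ?thesis using sg(2) unfolding colorable_def by blast
      next
        case False
        with \<open>\<not> connected_graph V' E'\<close> obtain u v where uv: "u \<in> V'" "v \<in> V'" "\<not> E'\<^sup>*\<^sup>* u v"
          unfolding connected_graph_def by blast
        define A where "A = {x \<in> V'. E'\<^sup>*\<^sup>* u x}"
        have AE: "x \<in> A \<longleftrightarrow> y \<in> A" if "E' x y" for x y
        proof -
          have "E' y x" "x \<in> V'" "y \<in> V'" using that sg by blast+
          then show ?thesis using that unfolding A_def by (auto intro: rtranclp.rtrancl_into_rtrancl)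
        qed
        have col: "colorable 4 S (induced E' S)" if "S \<subset> V'" for S
        proof (rule less.hyps)
          show "card S < card V'" using that sg(1) by (rule psubset_card_mono[rotated])
          then show "card S < card V" using less.prems(3) by simp
          show "simple_graph S (induced E' S)" using simple_graph_induced[OF less.prems(1)] that by blast
          show "planar S (induced E' S)"
            by (rule planar_subgraph[OF less.prems(2)]) (use that in \<open>auto simp: induced_def\<close>)
        qed
        have "A \<subset> V'" "V' - A \<subset> V'" using uv by (auto simp: A_def)
        then obtain c1 c2 :: "nat \<Rightarrow> nat" where c1: "\<forall>v\<in>A. c1 v < 4" "\<forall>u v. induced E' A u v \<longrightarrow> c1 u \<noteq> c1 v"
          and c2: "\<forall>v\<in>V' - A. c2 v < 4" "\<forall>u v. induced E' (V' - A) u v \<longrightarrow> c2 u \<noteq> c2 v"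
          using col[of A] col[of "V' - A"] unfolding colorable_def by blast
        let ?c = "\<lambda>x. if x \<in> A then c1 x else c2 x"
        have "?c x \<noteq> ?c y" if "E' x y" for x y
          using c1(2) c2(2) AE[OF that] sg(2,3)[OF that] that by (auto simp: induced_def)
        then show ?thesis using c1(1) c2(1) unfolding colorable_def by (intro exI[of _ ?c]) auto
      qed
    qed
  qed
qed

section \<open>Separating cliques, K4 and vertices of degree 5\<close>

definition component :: "('a \<Rightarrow> 'a \<Rightarrow> bool) \<Rightarrow> 'a set \<Rightarrow> 'a \<Rightarrow> 'a set" where
  "component E W w = {x. (induced E W)\<^sup>*\<^sup>* w x}"

lemma component_self: "w \<in> component E W w"
  by (simp add: component_def)

lemma component_nonempty: "component E W w \<noteq> {}"
  using component_self by (metis empty_iff)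

lemma component_subset:
  assumes "w \<in> W" shows "component E W w \<subseteq> W"
proof
  fix x assume "x \<in> component E W w"
  then have "(induced E W)\<^sup>*\<^sup>* w x" by (simp add: component_def)
  then show "x \<in> W" using assms by (induction rule: rtranclp_induct) (auto simp: induced_def)
qed

lemma component_step:
  assumes "x \<in> component E W w" "E x y" "x \<in> W" "y \<in> W"
  shows "y \<in> component E W w"
  using assms unfolding component_def by (auto simp: induced_def intro: rtranclp.rtrancl_into_rtrancl)

lemma conn_on_component:
  assumes "\<And>x y. E x y \<Longrightarrow> E y x"
  shows "conn_on E (component E W w)"
proof (rule conn_onI_root[where r = w])
  let ?C = "component E W w"
  fix x assume "x \<in> ?C"
  then have "(induced E W)\<^sup>*\<^sup>* w x" by (simp add: component_def)
  then show "(induced E ?C)\<^sup>*\<^sup>* w x"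
  proof (induction rule: rtranclp_induct)
    case (step y z)
    have "y \<in> ?C" "z \<in> ?C" using step(1,2) by (auto simp: component_def)
    then have "induced E ?C y z" using step(2) by (simp add: induced_def)
    then show ?case by (rule rtranclp.rtrancl_into_rtrancl[OF step(3)])
  qed simp
qed (use assms in auto)

lemma extend_inj_to_bij:
  assumes "f ` X \<subseteq> N" "inj_on f X" "X \<subseteq> N" "finite N"
  shows "\<exists>\<sigma>. bij_betw \<sigma> N N \<and> (\<forall>x\<in>X. \<sigma> x = f x)"
proof -
  have "card (N - X) = card (N - f ` X)"
    using assms by (simp add: card_Diff_subset finite_subset card_image)
  then obtain g where g: "bij_betw g (N - X) (N - f ` X)"
    using finite_same_card_bij[of "N - X" "N - f ` X"] assms(4) by auto
  let ?\<sigma> = "\<lambda>x. if x \<in> X then f x else g x"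
  have "bij_betw ?\<sigma> X (f ` X)" using assms(2) by (auto simp: bij_betw_def inj_on_def)
  moreover have "bij_betw ?\<sigma> (N - X) (N - f ` X)" using g by (subst bij_betw_cong[of _ _ g]) auto
  ultimately have "bij_betw ?\<sigma> (X \<union> (N - X)) (f ` X \<union> (N - f ` X))"
    by (rule bij_betw_combine) auto
  moreover have "X \<union> (N - X) = N" "f ` X \<union> (N - f ` X) = N" using assms by auto
  ultimately show ?thesis by (intro exI[of _ ?\<sigma>]) simp
qed

context min_noncolorable
begin

lemma not_proper: "\<not> proper E V c"
  using noncol sgD(2,3) unfolding colorable_def proper_def by blast

text \<open>Permuting the colours of one side makes the two colourings agree on the separator.\<close>

lemma glue_colorings:
  assumes AB: "A \<union> B = V" and edges: "\<And>x y. E x y \<Longrightarrow> x \<in> A \<and> y \<in> A \<or> x \<in> B \<and> y \<in> B"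
    and c1: "proper E A c1" "inj_on c1 (A \<inter> B)" and c2: "proper E B c2" "inj_on c2 (A \<inter> B)"
  shows False
proof -
  let ?T = "A \<inter> B" and ?f = "\<lambda>k. c1 (inv_into (A \<inter> B) c2 k)"
  have inv: "inv_into ?T c2 (c2 x) = x" if "x \<in> ?T" for x using that c2(2) by simp
  have "\<exists>\<sigma>. bij_betw \<sigma> {..<4} {..<4} \<and> (\<forall>k\<in>c2 ` ?T. \<sigma> k = ?f k)"
  proof (rule extend_inj_to_bij)
    show "?f ` c2 ` ?T \<subseteq> {..<4}" using c1(1) inv by (auto simp: proper_def)
    show "inj_on ?f (c2 ` ?T)" using inv c1(2) by (auto simp: inj_on_def)
    show "c2 ` ?T \<subseteq> {..<4}" using c2(1) by (auto simp: proper_def)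
  qed simp
  then obtain \<sigma> where \<sigma>: "bij_betw \<sigma> {..<4} {..<4}" "\<And>x. x \<in> ?T \<Longrightarrow> \<sigma> (c2 x) = c1 x"
    using inv by auto
  let ?c = "\<lambda>x. if x \<in> A then c1 x else \<sigma> (c2 x)"
  have cB: "?c x = \<sigma> (c2 x)" if "x \<in> B" for x using that \<sigma>(2) by simp
  have \<sigma>lt: "\<sigma> k < 4" if "k < 4" for k using \<sigma>(1) that by (auto simp: bij_betw_def)
  have \<sigma>inj: "\<sigma> k \<noteq> \<sigma> l" if "k < 4" "l < 4" "k \<noteq> l" for k l using \<sigma>(1) that by (auto simp: bij_betw_def inj_on_def)
  have "proper E V ?c" unfolding proper_def
  proof (intro conjI ballI impI)
    fix x assume "x \<in> V"
    then show "?c x < 4" using AB c1(1) c2(1) \<sigma>lt by (auto simp: proper_def)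
  next
    fix x y assume "E x y"
    then consider "x \<in> A" "y \<in> A" | "x \<in> B" "y \<in> B" using edges by blast
    then show "?c x \<noteq> ?c y"
    proof cases
      case 1
      then show ?thesis using c1(1) \<open>E x y\<close> by (simp add: proper_def)
    next
      case 2
      then have "\<sigma> (c2 x) \<noteq> \<sigma> (c2 y)" using c2(1) \<open>E x y\<close> by (intro \<sigma>inj) (auto simp: proper_def)
      then show ?thesis unfolding cB[OF 2(1)] cB[OF 2(2)] .
    qed
  qed
  then show False using not_proper by blast
qed

text \<open>Each side together with the clique is a smaller graph, hence colourable, and every
  colouring is injective on a clique, so the two colourings can be glued.\<close>

lemma no_clique_cut:
  assumes T: "T \<subseteq> V" "\<And>x y. x \<in> T \<Longrightarrow> y \<in> T \<Longrightarrow> x \<noteq> y \<Longrightarrow> E x y"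
    and D: "D \<subseteq> V - T" "D \<noteq> {}" "\<And>x y. x \<in> D \<Longrightarrow> E x y \<Longrightarrow> y \<in> D \<union> T"
    and rest: "V - D - T \<noteq> {}"
  shows False
proof -
  have "D \<union> T \<subset> V" using T(1) D(1) rest by blast
  then obtain c1 where c1: "proper E (D \<union> T) c1" using subgraph_coloring by blast
  have "V - D \<subset> V" using D(1,2) by blast
  then obtain c2 where c2: "proper E (V - D) c2" using subgraph_coloring by blast
  have eq: "(D \<union> T) \<inter> (V - D) = T" using T(1) D(1) by blast
  have inj: "inj_on c T" if "proper E A c" "T \<subseteq> A" for A c
    using that T(2) unfolding proper_def inj_on_def by (meson subsetD)
  have "T \<subseteq> V - D" using T(1) D(1) by blast
  then have "inj_on c1 T" "inj_on c2 T" using inj c1 c2 by auto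
  then show False
  proof (intro glue_colorings[of "D \<union> T" "V - D" c1 c2])
    show "D \<union> T \<union> (V - D) = V" using T(1) D(1) by blast
    fix x y assume "E x y"
    moreover from this have "x \<in> V" "y \<in> V" "E y x" using sgD by auto
    ultimately show "x \<in> D \<union> T \<and> y \<in> D \<union> T \<or> x \<in> V - D \<and> y \<in> V - D"
      using D(3)[of x y] D(3)[of y x] by blast
  qed (use c1 c2 eq in simp_all)
qed

lemma K5_minor_free:
  assumes "length Ss = 5" "\<And>X. X \<in> set Ss \<Longrightarrow> X \<subseteq> V \<and> X \<noteq> {} \<and> conn_on E X"
    "sorted_wrt (\<lambda>X Y. X \<inter> Y = {} \<and> adj E X Y) Ss"
  shows False
  using planar_no_K5_minor[OF sg pl assms] .

text \<open>A component of the graph without the four vertices either touches all four and forms a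
  K5 minor with them, or is cut off by a smaller clique from one that it misses. With no further
  vertex, four colours suffice at once.\<close>

lemma no_K4:
  assumes "distinct [k1, k2, k3, k4]"
    and K: "E k1 k2" "E k1 k3" "E k1 k4" "E k2 k3" "E k2 k4" "E k3 k4"
  shows False
proof -
  let ?K = "{k1, k2, k3, k4}"
  have clique: "E x y" if "x \<in> ?K" "y \<in> ?K" "x \<noteq> y" for x y using that K sgD(5) by blast
  have KV: "?K \<subseteq> V" using K sgD by blast
  show False
  proof (cases "V = ?K")
    case True
    let ?c = "\<lambda>x. if x = k1 then 0 else if x = k2 then 1 else if x = k3 then 2 else (3::nat)"
    have "proper E V ?c" unfolding True proper_def using assms(1) sgD(4) by auto
    then show False using not_proper by blast
  next
    case False
    then obtain w where w: "w \<in> V - ?K" using KV by blast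
    let ?D = "component E (V - ?K) w"
    have sub: "?D \<subseteq> V - ?K" by (rule component_subset[OF w])
    let ?T = "{k \<in> ?K. adj E ?D {k}}"
    show False
    proof (cases "?T = ?K")
      case True
      then have "adj E ?D {k1}" "adj E ?D {k2}" "adj E ?D {k3}" "adj E ?D {k4}" by blast+
      moreover have "adj E {x} {y}" if "E x y" for x y using that by (simp add: adj_def)
      ultimately show False
        using sub KV K assms(1) conn_on_component[of E, OF sgD(5)] component_nonempty[of E _ w]
        by (intro K5_minor_free[of "[?D, {k1}, {k2}, {k3}, {k4}]"]) auto
    next
      case False
      show False
      proof (rule no_clique_cut[of ?T ?D])
        show "?D \<noteq> {}" by (rule component_nonempty)
        show "y \<in> ?D \<union> ?T" if "x \<in> ?D" "E x y" for x y
          using component_step[OF that(1,2)] sub sgD(3)[OF that(2)] that by (auto simp: adj_def)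
        show "V - ?D - ?T \<noteq> {}" using False KV sub by blast
      qed (use clique KV sub in auto)
    qed
  qed
qed

text \<open>Contract \<open>v\<close> with the three vertices of \<open>S\<close>. In the
  pulled-back colouring these share a colour, so the five neighbours show at most three colours and
  a fourth is free for \<open>v\<close>; independence of \<open>S\<close> keeps the colouring
  proper.\<close>

lemma degree_five_no_independent_triple:
  assumes deg: "card (nbrs E v) = 5" and S: "S \<subseteq> nbrs E v" "card S = 3"
    and indep: "\<And>x y. x \<in> S \<Longrightarrow> y \<in> S \<Longrightarrow> \<not> E x y"
  shows False
proof -
  have fin: "finite (nbrs E v)" "finite S" using deg S by (auto intro: card_ge_0_finite)
  obtain s where s: "s \<in> S" using S(2) by fastforce
  have SV: "insert v S \<subseteq> V" using S(1) s sgD(2,3) unfolding nbrs_def by blast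
  have vs: "v \<noteq> s" using s S(1) sgD(4) by (auto simp: nbrs_def)
  have "conn_on E (insert v S)" using S(1) sgD(5) by (intro conn_on_star) (auto simp: nbrs_def)
  then obtain c where c: "\<And>x. x \<in> V \<Longrightarrow> c x < 4"
    "\<And>x y. x \<in> V \<Longrightarrow> y \<in> V \<Longrightarrow> E x y \<Longrightarrow> \<not> (x \<in> insert v S \<and> y \<in> insert v S) \<Longrightarrow> c x \<noteq> c y"
    "\<And>x. x \<in> insert v S \<Longrightarrow> c x = (c v :: nat)"
    using contract_coloring[OF SV order_refl, of v s] s vs by blast
  have "c ` nbrs E v \<subseteq> insert (c v) (c ` (nbrs E v - S))" using c(3) by blast
  then have "card (c ` nbrs E v) \<le> card (insert (c v) (c ` (nbrs E v - S)))"
    using fin by (intro card_mono) auto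
  also have "\<dots> \<le> Suc (card (nbrs E v - S))"
    using fin card_insert_le_m1 card_image_le[of "nbrs E v - S" c] by (simp add: card_insert_if)
  also have "\<dots> = 3" using deg S fin by (simp add: card_Diff_subset)
  finally have "card (c ` nbrs E v) < card {..<4::nat}" by simp
  then obtain k where k: "k < 4" "k \<notin> c ` nbrs E v"
    by (meson card_mono fin(1) finite_imageI lessThan_iff not_le subsetI)
  have "proper E V (c(v := k))" unfolding proper_def
  proof (intro conjI ballI impI)
    fix x y assume xy: "x \<in> V" "y \<in> V" "E x y"
    have "c x \<noteq> c y" if "x \<noteq> v" "y \<noteq> v" using c(2)[OF xy] indep xy(3) that by blast
    moreover have "c y \<noteq> k" if "x = v" using k(2) xy(3) that by (auto simp: nbrs_def)
    moreover have "c x \<noteq> k" if "y = v" using k(2) sgD(5)[OF xy(3)] that by (auto simp: nbrs_def)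
    ultimately show "(c(v := k)) x \<noteq> (c(v := k)) y" using sgD(4)[OF xy(3)] by auto
  qed (use c(1) k(1) in auto)
  then show False using not_proper by blast
qed

end

section \<open>The configuration and its ring\<close>

lemma conn_on_Un:
  assumes sym: "\<And>x y. E x y \<Longrightarrow> E y x" and A: "conn_on E A" and B: "conn_on E B" and r: "r \<in> A" "r \<in> B"
  shows "conn_on E (A \<union> B)"
proof (rule conn_onI_root[OF sym, where r = r])
  have mono: "(induced E (A \<union> B))\<^sup>*\<^sup>* x y" if "(induced E S)\<^sup>*\<^sup>* x y" "S \<subseteq> A \<union> B" for S x y
    using that(1) by (rule rtranclp_mono[THEN predicate2D, rotated]) (use that(2) in \<open>auto simp: induced_def\<close>)
  fix x assume "x \<in> A \<union> B"
  then have "(induced E A)\<^sup>*\<^sup>* r x \<or> (induced E B)\<^sup>*\<^sup>* r x" using A B r by (auto simp: conn_on_def)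
  then show "(induced E (A \<union> B))\<^sup>*\<^sup>* r x" using mono by blast
qed

lemma conn_on_insert:
  assumes sym: "\<And>x y. E x y \<Longrightarrow> E y x" and A: "conn_on E A" and r: "r \<in> A" "E x r"
  shows "conn_on E (insert x A)"
proof -
  have "conn_on E (insert r {x})" using sym r(2) by (intro conn_on_star) auto
  then have "conn_on E (A \<union> {r, x})" using conn_on_Un[of E A "{r, x}" r] sym A r(1) by simp
  moreover have "A \<union> {r, x} = insert x A" using r(1) by auto
  ultimately show ?thesis by simp
qed

lemma conn_on_successively:
  assumes sym: "\<And>x y. E x y \<Longrightarrow> E y x" and "successively E xs"
  shows "conn_on E (set xs)"
  using assms(2)
proof (induction xs)
  case (Cons x xs)
  show ?case
  proof (cases xs)
    case (Cons y ys)
    then have "E x y" "y \<in> set xs" "successively E xs" using Cons.prems by auto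
    then show ?thesis using conn_on_insert[OF sym Cons.IH, of y x] by simp
  qed simp
qed simp

lemma conn_on_walk:
  assumes "conn_on E S" "x \<in> S" "y \<in> S"
  shows "\<exists>xs. xs \<noteq> [] \<and> hd xs = x \<and> last xs = y \<and> set xs \<subseteq> S \<and> successively E xs"
proof -
  have "(induced E S)\<^sup>*\<^sup>* x y" using assms by (simp add: conn_on_def)
  then show ?thesis
  proof (induction rule: rtranclp_induct)
    case base
    show ?case using assms(2) by (intro exI[of _ "[x]"]) simp
  next
    case (step y z)
    then obtain xs where "xs \<noteq> []" "hd xs = x" "last xs = y" "set xs \<subseteq> S" "successively E xs" by blast
    then show ?case using step(2)
      by (intro exI[of _ "xs @ [z]"]) (auto simp: successively_append_iff induced_def)
  qed
qed

context min_noncolorable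
begin

text \<open>The form in which the absence of independent triples supplies edges around a vertex of
  degree 5, in place of the cyclic order in a drawing.\<close>

lemma degree_five_third_edge:
  assumes "card (nbrs E v) = 5" "E v x" "E v y" "E v z" "distinct [x, y, z]" "\<not> E x y" "\<not> E x z"
  shows "E y z"
proof (rule ccontr)
  assume "\<not> E y z"
  then have "\<not> E p q" if "p \<in> {x, y, z}" "q \<in> {x, y, z}" for p q
    using assms that sgD(5,6) by blast
  moreover have "{x, y, z} \<subseteq> nbrs E v" "card {x, y, z} = 3" using assms by (auto simp: nbrs_def)
  ultimately show False using degree_five_no_independent_triple[OF assms(1)] by blast
qed

end

text \<open>The ring y, z, v2, c, v4, v5, x is listed in cyclic order. Its last vertex x is tied to y and
  v5 only through their common neighbour d.\<close>

locale ring_config = min_noncolorable +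
  fixes a b d v1 y z v2 c v4 v5 x :: 'a
  assumes dist: "distinct [a, b, d, v1, y, z, v2, c, v4, v5, x]"
    and Na: "nbrs E a = {b, c, d, v1, v2}" and Nb: "nbrs E b = {a, c, d, v4, v5}"
    and Nd: "nbrs E d = {a, b, v1, v5, y, x}" and Nv1: "nbrs E v1 = {a, d, v2, y, z}"
    and ring: "E y z" "E z v2" "E v2 c" "E c v4" "E v4 v5" and chord: "\<not> E v2 y"

context min_noncolorable
begin

text \<open>The edge would close a triangle v1, d, v5. As d has degree 6, it has a neighbour
  \<open>w\<close> besides a, b, v1, v5. The component of \<open>w\<close> off the triangle and a, b
  either misses c, v2, v4, and the triangle separates it from a, or contains all three and forms a
  K5 minor with {v1}, {d}, {v5}, {a, b}. This later keeps y and z apart from v5.\<close>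

lemma triangle_no_v1_v5:
  assumes dist: "distinct [a, b, c, d, v1, v2, v3, v4, v5]"
    and Na: "nbrs E a = {b, c, d, v1, v2}" and Nb: "nbrs E b = {a, c, d, v4, v5}"
    and Nc: "nbrs E c = {a, b, v2, v3, v4}"
    and dd: "card (nbrs E d) = 6" and dv: "E d v1" "E d v5" "E v1 v2" "E v4 v5"
  shows "\<not> E v1 v5"
proof
  assume v15: "E v1 v5"
  have Ea: "E a t \<longleftrightarrow> t \<in> {b, c, d, v1, v2}" and Eb: "E b t \<longleftrightarrow> t \<in> {a, c, d, v4, v5}"
    and Ec: "E c t \<longleftrightarrow> t \<in> {a, b, v2, v3, v4}" for t
    using Na Nb Nc by (auto simp: nbrs_def set_eq_iff)
  let ?T = "{v1, d, v5}"
  have TV: "?T \<subseteq> V" and abV: "a \<in> V" "b \<in> V" "c \<in> V" "v2 \<in> V" "v4 \<in> V"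
    using dv v15 sgD(2,3) Ea[of b] Ea[of c] by blast+
  have T: "E p q" if "p \<in> ?T" "q \<in> ?T" "p \<noteq> q" for p q using that dv v15 sgD(5) by blast
  have "card {a, b, v1, v5} \<le> 4" by (simp add: card_insert_if)
  then have "\<not> nbrs E d \<subseteq> {a, b, v1, v5}" using dd card_mono[of "{a, b, v1, v5}" "nbrs E d"] by auto
  then obtain w where w: "E d w" "w \<notin> {a, b, v1, v5}" by (auto simp: nbrs_def)
  let ?W = "V - ?T - {a, b}" and ?D = "component E (V - {v1, d, v5} - {a, b}) w"
  have wW: "w \<in> ?W" using w sgD(3,4) by blast
  have sub: "?D \<subseteq> ?W" by (rule component_subset[OF wW])
  have cW: "c \<in> ?W" "v2 \<in> ?W" "v4 \<in> ?W" using abV dist by auto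
  have "?D \<inter> {c, v2, v4} \<noteq> {}"
  proof
    assume none: "?D \<inter> {c, v2, v4} = {}"
    show False
    proof (rule no_clique_cut[of ?T ?D])
      show "?T \<subseteq> V" by (rule TV)
      show "?D \<subseteq> V - ?T" using sub by blast
      show "?D \<noteq> {}" by (rule component_nonempty)
      have "a \<notin> ?D" using sub by blast
      then show "V - ?D - ?T \<noteq> {}" using abV(1) dist by auto
      fix p q assume pq: "p \<in> ?D" "E p q"
      show "q \<in> ?D \<union> ?T"
      proof (cases "q \<in> ?W")
        case True
        then show ?thesis using component_step[OF pq _ True] sub pq(1) by blast
      next
        case False
        \<comment> \<open>Apart from the triangle and each other, a and b have only c, v2, v4 as
          neighbours.\<close>
        have "q \<noteq> a" "q \<noteq> b" using sgD(5)[OF pq(2)] Ea[of p] Eb[of p] none sub pq(1) by auto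
        then show ?thesis using False sgD(3)[OF pq(2)] by blast
      qed
    qed (use T in auto)
  qed
  moreover have "E c v2" "E c v4" "E v2 c" "E v4 c" using Ec sgD(5) by auto
  then have "c \<in> ?D" if "v2 \<in> ?D \<or> v4 \<in> ?D" using that cW component_step by metis
  ultimately have cD: "c \<in> ?D" by blast
  then have D: "v2 \<in> ?D" "v4 \<in> ?D" using component_step[OF cD _ cW(1)] cW \<open>E c v2\<close> \<open>E c v4\<close> by blast+
  have ab: "conn_on E {a, b}" using Ea[of b] sgD(5) by (intro conn_on_star) auto
  show False
  proof (rule K5_minor_free[of "[{v1}, {d}, {v5}, {a, b}, ?D]"])
    have "E v1 a" "E d a" "E v5 b" "E d v1" "E v1 d" "E b c" using Ea Eb dv sgD(5) by blast+
    moreover have "E v5 v4" using dv sgD(5) by blast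
    ultimately have "adj E {v1} {d}" "adj E {v1} {v5}" "adj E {v1} {a, b}" "adj E {v1} ?D" "adj E {d} {v5}"
      "adj E {d} {a, b}" "adj E {d} ?D" "adj E {v5} {a, b}" "adj E {v5} ?D" "adj E {a, b} ?D"
      using v15 dv D cD w component_self[of w E ?W] unfolding adj_def by blast+
    then show "sorted_wrt (\<lambda>X Y. X \<inter> Y = {} \<and> adj E X Y) [{v1}, {d}, {v5}, {a, b}, ?D]"
      using sub dist by auto
    show "X \<subseteq> V \<and> X \<noteq> {} \<and> conn_on E X" if "X \<in> set [{v1}, {d}, {v5}, {a, b}, ?D]" for X
      using that sub TV abV ab conn_on_component[of E, OF sgD(5)] component_nonempty[of E _ w] by auto
  qed simp
qed

text \<open>Degree 5 at a, b, c gives the edges between consecutive neighbours. The two further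
  neighbours of v1 are adjacent to each other, each is adjacent to d or v2, and the absence of K4
  forbids that both have the same of these two: this names \<open>y\<close> at d and
  \<open>z\<close> at v2. The sixth neighbour of d is \<open>x\<close>.\<close>

lemma ring_config_exists:
  assumes dist: "distinct [a, b, c, d, v1, v2, v3, v4, v5]"
    and Na: "nbrs E a = {b, c, d, v1, v2}" and Nb: "nbrs E b = {a, c, d, v4, v5}"
    and Nc: "nbrs E c = {a, b, v2, v3, v4}"
    and dd: "card (nbrs E d) = 6" and d1: "card (nbrs E v1) = 5"
  shows "\<exists>y z x. ring_config V E a b d v1 y z v2 c v4 v5 x"
proof -
  have Ea: "E a t \<longleftrightarrow> t \<in> {b, c, d, v1, v2}" and Eb: "E b t \<longleftrightarrow> t \<in> {a, c, d, v4, v5}"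
    and Ec: "E c t \<longleftrightarrow> t \<in> {a, b, v2, v3, v4}" for t
    using Na Nb Nc by (auto simp: nbrs_def set_eq_iff)
  have sym: "E s t \<longleftrightarrow> E t s" for s t using sgD(5) by blast
  have Eat: "E t a \<longleftrightarrow> t \<in> {b, c, d, v1, v2}" for t unfolding sym[of t a] by (rule Ea)
  have Ebt: "E t b \<longleftrightarrow> t \<in> {a, c, d, v4, v5}" for t unfolding sym[of t b] by (rule Eb)
  have Ect: "E t c \<longleftrightarrow> t \<in> {a, b, v2, v3, v4}" for t unfolding sym[of t c] by (rule Ec)
  have deg: "card (nbrs E a) = 5" "card (nbrs E b) = 5" "card (nbrs E c) = 5"
    using dist unfolding Na Nb Nc by auto
  note N = Ea Eb Ec Eat Ebt Ect
  have dv1: "E d v1" by (rule degree_five_third_edge[OF deg(1), of c]) (use dist in \<open>auto simp: N\<close>)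
  have v12: "E v1 v2" by (rule degree_five_third_edge[OF deg(1), of b]) (use dist in \<open>auto simp: N\<close>)
  have dv5: "E d v5" by (rule degree_five_third_edge[OF deg(2), of c]) (use dist in \<open>auto simp: N\<close>)
  have v45: "E v4 v5" by (rule degree_five_third_edge[OF deg(2), of a]) (use dist in \<open>auto simp: N\<close>)
  have v34: "E v3 v4" by (rule degree_five_third_edge[OF deg(3), of a]) (use dist in \<open>auto simp: N\<close>)
  have v23: "E v2 v3" by (rule degree_five_third_edge[OF deg(3), of b]) (use dist in \<open>auto simp: N\<close>)
  have v15: "\<not> E v1 v5" by (rule triangle_no_v1_v5[OF dist Na Nb Nc dd dv1 dv5 v12 v45])
  have dv2: "\<not> E d v2"
    using no_K4[of a d v1 v2] dist dv1 v12 by (auto simp: N)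
  have sub1: "{a, d, v2} \<subseteq> nbrs E v1" using v12 dv1 sgD(5) by (auto simp: nbrs_def N)
  then have "card (nbrs E v1 - {a, d, v2}) = 2" using d1 dist by (subst card_Diff_subset) auto
  then obtain p q where pq: "nbrs E v1 - {a, d, v2} = {p, q}" "p \<noteq> q" by (auto simp: card_2_iff)
  have Nv1: "nbrs E v1 = {a, d, v2, p, q}" using pq(1) sub1 by blast
  have pq': "p \<notin> {a, d, v2}" "q \<notin> {a, d, v2}" using pq(1) by blast+
  have Ev1: "E v1 t \<longleftrightarrow> t \<in> {a, d, v2, p, q}" for t using Nv1 by (auto simp: nbrs_def)
  have v1bc: "\<not> E v1 b" "\<not> E v1 c" using dist by (auto simp: N)
  have v1pq: "p \<notin> {b, c, v1}" "q \<notin> {b, c, v1}" using Ev1[of p] Ev1[of q] v1bc sgD(6) by auto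
  have pq_a: "\<not> E a p" "\<not> E a q" using pq' v1pq by (auto simp: N)
  have Epq: "E p q" by (rule degree_five_third_edge[OF d1, of a]) (use pq pq' pq_a in \<open>auto simp: Ev1\<close>)
  have one: "E d t \<or> E v2 t" if "t \<in> {p, q}" for t
    using degree_five_third_edge[OF d1, of d v2 t] that pq' dist dv2 by (auto simp: Ev1)
  have notboth: "\<not> (E d p \<and> E d q)" "\<not> (E v2 p \<and> E v2 q)"
    using no_K4[of v1 d p q] no_K4[of v1 v2 p q] Epq pq(2) pq' v1pq dist sgD(5)[OF dv1] v12 by (auto simp: Ev1)
  have "\<exists>y z. {y, z} = {p, q} \<and> E d y \<and> E v2 z \<and> \<not> E d z \<and> \<not> E v2 y"
    using one notboth by blast
  then obtain y z where yz: "{y, z} = {p, q}" "E d y" "E v2 z" "\<not> E d z" "\<not> E v2 y" by blast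
  have Eyz: "E y z" and yz_ne: "y \<noteq> z"
    using yz(1) Epq pq(2) sgD(5) by (auto simp: doubleton_eq_iff)
  have Nv1': "nbrs E v1 = {a, d, v2, y, z}" using Nv1 yz(1) by auto
  have yz_out: "y \<notin> {a, b, c, d, v1, v2}" "z \<notin> {a, b, c, d, v1, v2}"
    using pq' v1pq yz(1) by (auto simp: doubleton_eq_iff)
  have v1yz: "E v1 y" "E v1 z" using yz(1) Ev1 by blast+
  have dv4: "\<not> E d v4"
    using no_K4[of b d v4 v5] dist dv5 v45 by (auto simp: N)
  have v24: "\<not> E v2 v4"
    using no_K4[of c v2 v3 v4] dist v23 v34 by (auto simp: N)
  have yz_v: "y \<noteq> v4" "y \<noteq> v5" "z \<noteq> v4" "z \<noteq> v5" using v15 dv4 v24 yz v1yz by blast+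
  have sub2: "{a, b, v1, v5, y} \<subseteq> nbrs E d" using dv1 dv5 yz(2) by (auto simp: nbrs_def N)
  have "card {a, b, v1, v5, y} = 5" using dist yz_out yz_v by auto
  then have "card (nbrs E d - {a, b, v1, v5, y}) = 1" using dd sub2 by (subst card_Diff_subset) auto
  then obtain x where x: "nbrs E d - {a, b, v1, v5, y} = {x}" by (auto simp: card_1_singleton_iff)
  have Nd: "nbrs E d = {a, b, v1, v5, y, x}" using x sub2 by blast
  have "E d x" "x \<notin> {a, b, v1, v5, y}" using x by (auto simp: nbrs_def)
  moreover have "\<not> E d c" using dist by (auto simp: N)
  ultimately have x_out: "x \<notin> {a, b, c, d, v1, v2, v4, v5, y, z}" using dv2 dv4 yz(4) sgD(6) by auto
  have "ring_config V E a b d v1 y z v2 c v4 v5 x"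
  proof
    show "distinct [a, b, d, v1, y, z, v2, c, v4, v5, x]" using dist yz_out yz_v yz_ne x_out by auto
  qed (use Na Nb Nd Nv1' Eyz yz(3,5) sgD(5) v45 in \<open>auto simp: N\<close>)
  then show ?thesis by blast
qed

end

section \<open>Kempe chains cannot cross\<close>

context ring_config
begin

definition \<rho> :: "nat \<Rightarrow> 'a" where "\<rho> i = [y, z, v2, c, v4, v5, x] ! i"

definition W :: "'a set" where "W = V - {a, b, d, v1}"

lemma edge_iff:
  "E a t \<longleftrightarrow> t \<in> {b, c, d, v1, v2}" "E b t \<longleftrightarrow> t \<in> {a, c, d, v4, v5}"
  "E d t \<longleftrightarrow> t \<in> {a, b, v1, v5, y, x}" "E v1 t \<longleftrightarrow> t \<in> {a, d, v2, y, z}"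
  using Na Nb Nd Nv1 by (auto simp: nbrs_def set_eq_iff)

lemma rho_simps [simp]:
  "\<rho> 0 = y" "\<rho> (Suc 0) = z" "\<rho> 2 = v2" "\<rho> 3 = c" "\<rho> 4 = v4" "\<rho> 5 = v5" "\<rho> 6 = x"
  by (simp_all add: \<rho>_def)

lemma less7: "i < 7 \<longleftrightarrow> i \<in> {0, Suc 0, 2, 3, 4, 5, 6 :: nat}"
  by auto

lemma rho_eq_iff: "i < 7 \<Longrightarrow> j < 7 \<Longrightarrow> \<rho> i = \<rho> j \<longleftrightarrow> i = j"
  unfolding \<rho>_def using dist by (intro nth_eq_iff_index_eq) auto

lemma rho_inj: "S \<subseteq> {..<7} \<Longrightarrow> inj_on \<rho> S"
  using rho_eq_iff by (auto simp: inj_on_def)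

lemma rho_in_W: "i < 7 \<Longrightarrow> \<rho> i \<in> W"
proof -
  have "y \<in> V" "z \<in> V" "v2 \<in> V" "c \<in> V" "v4 \<in> V" "v5 \<in> V" "x \<in> V"
    using ring edge_iff(3)[of x] sgD(2,3) by blast+
  then show "i < 7 \<Longrightarrow> \<rho> i \<in> W" using dist unfolding less7 W_def by (elim insertE) auto
qed

lemma ring_edge: "i < 5 \<Longrightarrow> E (\<rho> i) (\<rho> (Suc i))"
proof -
  assume "i < 5"
  then have "i \<in> {0, Suc 0, 2, 3, 4}" by auto
  then show ?thesis using ring by (elim insertE) (simp_all add: \<rho>_def)
qed

lemma conn_successively: "successively E xs \<Longrightarrow> conn_on E (set xs)"
  by (rule conn_on_successively) (rule sgD(5))

lemma conn_Un: "conn_on E A \<Longrightarrow> conn_on E B \<Longrightarrow> r \<in> A \<Longrightarrow> r \<in> B \<Longrightarrow> conn_on E (A \<union> B)"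
  by (rule conn_on_Un[of E A B r]) (simp_all add: sgD(5))

lemma conn_insert: "conn_on E A \<Longrightarrow> r \<in> A \<Longrightarrow> E t r \<Longrightarrow> conn_on E (insert t A)"
  by (rule conn_on_insert[of E A r t]) (simp_all add: sgD(5))

lemma conn_star: "(\<And>t. t \<in> S \<Longrightarrow> E r t) \<Longrightarrow> conn_on E (insert r S)"
  by (rule conn_on_star[of E S r]) (simp_all add: sgD(5))

lemma conn_on_ring_segment:
  assumes "n \<le> 6"
  shows "conn_on E (\<rho> ` {m..<n})"
proof -
  have "successively E (map \<rho> [m..<n])"
    using assms by (auto simp: successively_conv_nth intro!: ring_edge)
  then have "conn_on E (set (map \<rho> [m..<n]))" by (rule conn_successively)
  then show ?thesis by simp
qed

definition ring_walk :: "'a list \<Rightarrow> nat \<Rightarrow> nat \<Rightarrow> bool" where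
  "ring_walk xs p q \<longleftrightarrow> xs \<noteq> [] \<and> hd xs = \<rho> p \<and> last xs = \<rho> q \<and> successively E xs \<and> set xs \<subseteq> W \<and> p < 7 \<and> q < 7"

lemma ring_walk_rev: "ring_walk xs p q \<Longrightarrow> ring_walk (rev xs) q p"
  using sgD(5) unfolding ring_walk_def
  by (auto simp: hd_rev last_rev successively_rev elim: successively_mono)

lemma ring_walk_ends: "ring_walk xs p q \<Longrightarrow> \<rho> p \<in> set xs \<and> \<rho> q \<in> set xs"
  unfolding ring_walk_def by (metis hd_in_set last_in_set)

lemma ring_walk_decomp:
  assumes "ring_walk xs p q" "p \<noteq> q"
  shows "\<exists>m. xs = \<rho> p # m @ [\<rho> q]"
proof -
  from assms(1) obtain ys where ys: "xs = \<rho> p # ys" unfolding ring_walk_def by (cases xs) auto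
  then have "ys \<noteq> []" using assms rho_eq_iff[of p q] unfolding ring_walk_def by auto
  then have "ys = butlast ys @ [\<rho> q]" using assms(1) ys unfolding ring_walk_def by (metis append_butlast_last_id last_ConsR)
  then show ?thesis using ys by metis
qed

text \<open>Cutting the ring at the four ends of the walks, with d closing it between v5 and y, and taking
  {a, b, v1} as the hub yields a K5 minor.\<close>

lemma no_minimal_crossing:
  assumes ord: "i < j" "j < k" "k < l" "l < 7"
    and xs: "ring_walk (\<rho> i # m @ [\<rho> k]) i k" and m: "set m \<inter> \<rho> ` {..<7} = {}"
    and ys: "ring_walk (\<rho> j # n @ [\<rho> l]) j l" and n: "set n \<inter> \<rho> ` {..<7} = {}"
    and disj: "set m \<inter> set n = {}"
  shows False
proof -
  let ?X = "set (\<rho> i # m)" and ?Y = "set (\<rho> j # n)"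
  \<comment> \<open>Each walk, without its last vertex, is added to the segment of its first vertex,
    so its last edge links \<open>?B1\<close> to \<open>?B3\<close> or \<open>?B2\<close> to
    \<open>?B4\<close>. Ring edges link consecutive segments; d links \<open>?B4\<close> to y and,
    when \<open>l = 6\<close>, to v5.\<close>
  let ?B1 = "\<rho> ` {0..<j} \<union> ?X" and ?B2 = "\<rho> ` {j..<k} \<union> ?Y" and ?B3 = "\<rho> ` {k..<l}"
    and ?B4 = "insert d (\<rho> ` {l..<7})" and ?B5 = "{a, b, v1}"
  have X: "successively E (\<rho> i # m @ [\<rho> k])" "set m \<subseteq> W" and Y: "successively E (\<rho> j # n @ [\<rho> l])" "set n \<subseteq> W"
    using xs ys by (auto simp: ring_walk_def)
  have "successively E (\<rho> i # m) \<and> E (last (\<rho> i # m)) (\<rho> k)"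
    using X(1) successively_append_iff[of E "\<rho> i # m" "[\<rho> k]"] by simp
  then have cX: "conn_on E ?X" and lX: "E (last (\<rho> i # m)) (\<rho> k)"
    using conn_successively by blast+
  have "successively E (\<rho> j # n) \<and> E (last (\<rho> j # n)) (\<rho> l)"
    using Y(1) successively_append_iff[of E "\<rho> j # n" "[\<rho> l]"] by simp
  then have cY: "conn_on E ?Y" and lY: "E (last (\<rho> j # n)) (\<rho> l)"
    using conn_successively by blast+
  have c1: "conn_on E ?B1" using ord cX
    by (intro conn_Un[where r = "\<rho> i"] conn_on_ring_segment) auto
  have c2: "conn_on E ?B2" using ord cY
    by (intro conn_Un[where r = "\<rho> j"] conn_on_ring_segment) auto
  have c3: "conn_on E ?B3" using ord by (intro conn_on_ring_segment) auto
  have c4: "conn_on E ?B4"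
  proof -
    have "conn_on E (insert d (\<rho> ` {l..<6}))"
    proof (cases "l = 6")
      case False
      then have "5 \<in> {l..<6}" using ord by auto
      then have "\<rho> 5 \<in> \<rho> ` {l..<6}" by blast
      then have "v5 \<in> \<rho> ` {l..<6}" by simp
      moreover have "E d v5" by (simp add: edge_iff)
      ultimately show ?thesis by (intro conn_insert[where r = v5] conn_on_ring_segment) auto
    qed simp
    moreover have "E x d" using edge_iff(3)[of x] sgD(5) by blast
    ultimately have "conn_on E (insert x (insert d (\<rho> ` {l..<6})))"
      using conn_insert[of "insert d (\<rho> ` {l..<6})" d x] by simp
    moreover have "{l..<7} = insert 6 {l..<6}" using ord by auto
    ultimately show ?thesis by (simp add: insert_commute)
  qed
  have c5: "conn_on E ?B5"
  proof -
    have "conn_on E (insert a {b, v1})" by (intro conn_star) (auto simp: edge_iff)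
    then show ?thesis .
  qed
  have hubW: "W \<inter> {a, b, v1, d} = {}" by (auto simp: W_def)
  have W1: "?B1 \<subseteq> W" and W2: "?B2 \<subseteq> W" and W3: "?B3 \<subseteq> W" and W4: "\<rho> ` {l..<7} \<subseteq> W"
    using rho_in_W ord X(2) Y(2) by auto
  have seg: "\<rho> ` A \<inter> \<rho> ` B = {}" if "A \<subseteq> {..<7}" "B \<subseteq> {..<7}" "A \<inter> B = {}" for A B
    using inj_on_image_Int[OF rho_inj[OF order_refl] that(1,2)] that(3) by simp
  \<comment> \<open>Position 6 is excluded because x is adjacent to none of a, b, v1;
    \<open>?B4\<close> reaches the hub through d.\<close>
  have hub: "adj E (insert (\<rho> t) S) ?B5" if "t < 6" for t S
  proof -
    have "t \<in> {0, Suc 0, 2, 3, 4, 5}" using that by auto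
    then have "\<exists>h\<in>?B5. E h (\<rho> t)" by (elim insertE) (auto simp: edge_iff)
    then show ?thesis using sgD(5) unfolding adj_def by blast
  qed
  have hub': "adj E S ?B5" if "t < 6" "\<rho> t \<in> S" for t S using hub[OF that(1), of S] that(2) by (simp add: insert_absorb)
  have step: "adj E A B" if "t < 5" "\<rho> t \<in> A" "\<rho> (Suc t) \<in> B" for t A B
    using ring_edge[OF that(1)] that(2,3) unfolding adj_def by blast
  have e5: "E v5 d" "E y d" using edge_iff(3) sgD(5) by blast+
  have mem: "\<rho> t \<in> \<rho> ` S" if "t \<in> S" for t S using that by simp
  show False
  proof (rule K5_minor_free[of "[?B1, ?B2, ?B3, ?B4, ?B5]"])
    show "X \<subseteq> V \<and> X \<noteq> {} \<and> conn_on E X" if "X \<in> set [?B1, ?B2, ?B3, ?B4, ?B5]" for X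
    proof -
      have "W \<subseteq> V" by (auto simp: W_def)
      moreover have "a \<in> V" "b \<in> V" "d \<in> V" "v1 \<in> V"
        using edge_iff(1)[of b] edge_iff(1)[of d] edge_iff(1)[of v1] sgD(2,3) by blast+
      ultimately have "X \<subseteq> V" using that W1 W2 W3 W4 by auto
      moreover have "X \<noteq> {}" using that ord by auto
      moreover have "conn_on E X" using that c1 c2 c3 c4 c5 by auto
      ultimately show ?thesis by blast
    qed
    have B: "?B1 = \<rho> ` {0..<j} \<union> set m" "?B2 = \<rho> ` {j..<k} \<union> set n" using ord by auto
    have sub7: "{0..<j} \<subseteq> {..<7}" "{j..<k} \<subseteq> {..<7}" "{k..<l} \<subseteq> {..<7}" "{l..<7} \<subseteq> {..<7}"
      using ord by auto
    have mn: "set m \<inter> \<rho> ` A = {}" "set n \<inter> \<rho> ` A = {}" if "A \<subseteq> {..<7}" for A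
      using m n image_mono[OF that, of \<rho>] by blast+
    have i7: "{0..<j} \<inter> {j..<k} = {}" "{0..<j} \<inter> {k..<l} = {}" "{0..<j} \<inter> {l..<7} = {}"
      "{j..<k} \<inter> {k..<l} = {}" "{j..<k} \<inter> {l..<7} = {}" "{k..<l} \<inter> {l..<7} = {}"
      using ord by auto
    note s7 = seg[OF sub7(1,2) i7(1)] seg[OF sub7(1,3) i7(2)] seg[OF sub7(1,4) i7(3)]
      seg[OF sub7(2,3) i7(4)] seg[OF sub7(2,4) i7(5)] seg[OF sub7(3,4) i7(6)]
    have d12: "?B1 \<inter> ?B2 = {}" unfolding B using s7(1) mn(1)[OF sub7(2)] mn(2)[OF sub7(1)] disj by blast
    have "?B1 \<inter> ?B3 = {}" unfolding B using s7(2) mn(1)[OF sub7(3)] by blast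
    moreover have "?B1 \<inter> \<rho> ` {l..<7} = {}" unfolding B using s7(3) mn(1)[OF sub7(4)] by blast
    moreover have "?B2 \<inter> ?B3 = {}" unfolding B using s7(4) mn(2)[OF sub7(3)] by blast
    moreover have "?B2 \<inter> \<rho> ` {l..<7} = {}" unfolding B using s7(5) mn(2)[OF sub7(4)] by blast
    moreover note s7(6)
    moreover have "d \<notin> {a, b, v1}" using dist by auto
    moreover have off: "d \<notin> S" "S \<inter> {a, b, v1} = {}" if "S \<subseteq> W" for S using that hubW by auto
    ultimately have D: "?B1 \<inter> ?B3 = {}" "?B1 \<inter> ?B4 = {}" "?B1 \<inter> ?B5 = {}" "?B2 \<inter> ?B3 = {}"
      "?B2 \<inter> ?B4 = {}" "?B2 \<inter> ?B5 = {}" "?B3 \<inter> ?B4 = {}" "?B3 \<inter> ?B5 = {}" "?B4 \<inter> ?B5 = {}"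
      using off[OF W1] off[OF W2] off[OF W3] off[OF W4] by (simp_all only: Int_insert_right_if0 Int_insert_left_if0 simp_thms)
    have "adj E ?B1 ?B2" using step[of "j - 1"] ord by (simp add: mem)
    moreover have "adj E ?B2 ?B3" using step[of "k - 1"] ord by (simp add: mem)
    moreover have "adj E ?B3 ?B4"
    proof (cases "l = 6")
      case True
      then have "\<rho> 5 \<in> ?B3" using ord by (intro mem) auto
      then have "v5 \<in> ?B3" by (simp only: rho_simps)
      then show ?thesis using e5(1) unfolding adj_def by blast
    next
      case False
      then show ?thesis using step[of "l - 1"] ord by (simp add: mem)
    qed
    moreover have "adj E ?B1 ?B3"
    proof -
      have "last (\<rho> i # m) \<in> ?X" by (rule last_in_set) simp
      moreover have "\<rho> k \<in> ?B3" using ord by simp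
      ultimately show ?thesis using lX unfolding adj_def by blast
    qed
    moreover have "adj E ?B2 ?B4"
    proof -
      have "last (\<rho> j # n) \<in> ?Y" by (rule last_in_set) simp
      moreover have "\<rho> l \<in> ?B4" using ord by simp
      ultimately show ?thesis using lY unfolding adj_def by blast
    qed
    moreover have "adj E ?B1 ?B4"
    proof -
      have "\<rho> 0 \<in> \<rho> ` {0..<j}" using ord by (intro mem) auto
      then have "y \<in> \<rho> ` {0..<j}" by (simp only: rho_simps)
      then show ?thesis using e5(2) unfolding adj_def by blast
    qed
    moreover have "adj E ?B1 ?B5" using hub'[of i] ord by auto
    moreover have "adj E ?B2 ?B5" using hub'[of j] ord by auto
    moreover have "adj E ?B3 ?B5" using hub'[of k] ord by auto
    moreover have "adj E ?B4 ?B5" using edge_iff(3)[of a] by (auto simp: adj_def)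
    ultimately show "sorted_wrt (\<lambda>X Y. X \<inter> Y = {} \<and> adj E X Y) [?B1, ?B2, ?B3, ?B4, ?B5]"
      using d12 D by (simp only: sorted_wrt.simps list.set ball_simps simp_thms)
  qed simp
qed

text \<open>The last premise is interlacing: exactly one of \<open>r\<close>, \<open>s\<close> lies
  between \<open>p\<close> and \<open>q\<close>. Written as an exclusive or it is additive, so when
  a walk is cut at an inner ring vertex, one of the two pieces still interlaces with the other walk.
  Induction on the total length ends with walks whose inner vertices are off the ring.\<close>

lemma no_crossing_walks:
  assumes "ring_walk xs p q" "ring_walk ys r s" "set xs \<inter> set ys = {}"
    and "((p < r) \<noteq> (q < r)) \<noteq> ((p < s) \<noteq> (q < s))"
  shows False
  using assms
proof (induction "length xs + length ys" arbitrary: xs ys p q r s rule: less_induct)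
  case less
  have lt: "p < 7" "q < 7" "r < 7" "s < 7" using less.prems by (auto simp: ring_walk_def)
  have ne: "p \<noteq> r" "p \<noteq> s" "q \<noteq> r" "q \<noteq> s"
    using ring_walk_ends[OF less.prems(1)] ring_walk_ends[OF less.prems(2)] less.prems(3) by auto
  have pq: "p \<noteq> q" and rs: "r \<noteq> s" using less.prems(4) by auto
  obtain m where m: "xs = \<rho> p # m @ [\<rho> q]" using ring_walk_decomp[OF less.prems(1) pq] by blast
  obtain n where n: "ys = \<rho> r # n @ [\<rho> s]" using ring_walk_decomp[OF less.prems(2) rs] by blast
  have split: "ring_walk (\<rho> p # A @ [\<rho> t]) p t \<and> ring_walk (\<rho> t # B @ [\<rho> q]) t q"
    if "ring_walk (\<rho> p # (A @ \<rho> t # B) @ [\<rho> q]) p q" "t < 7" for p q t A B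
  proof -
    have "successively E ((\<rho> p # A @ [\<rho> t]) @ (B @ [\<rho> q]))" "successively E ((\<rho> p # A) @ (\<rho> t # B @ [\<rho> q]))"
      using that(1) by (simp_all add: ring_walk_def)
    then have "successively E (\<rho> p # A @ [\<rho> t])" "successively E (\<rho> t # B @ [\<rho> q])"
      by (simp_all only: successively_append_iff)
    then show ?thesis using that by (auto simp: ring_walk_def)
  qed
  show False
  proof (cases "set m \<inter> \<rho> ` {..<7} = {} \<and> set n \<inter> \<rho> ` {..<7} = {}")
    case True
    have rev_x: "ring_walk (\<rho> q # rev m @ [\<rho> p]) q p" using ring_walk_rev[OF less.prems(1)] m by simp
    have rev_y: "ring_walk (\<rho> s # rev n @ [\<rho> r]) s r" using ring_walk_rev[OF less.prems(2)] n by simp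
    have "\<exists>m'. ring_walk (\<rho> (min p q) # m' @ [\<rho> (max p q)]) (min p q) (max p q) \<and> set m' = set m"
      using less.prems(1) rev_x m by (cases "p < q") (auto simp: min_def max_def intro: exI[of _ m] exI[of _ "rev m"])
    then obtain m' where m': "ring_walk (\<rho> (min p q) # m' @ [\<rho> (max p q)]) (min p q) (max p q)" "set m' = set m"
      by blast
    have "\<exists>n'. ring_walk (\<rho> (min r s) # n' @ [\<rho> (max r s)]) (min r s) (max r s) \<and> set n' = set n"
      using less.prems(2) rev_y n by (cases "r < s") (auto simp: min_def max_def intro: exI[of _ n] exI[of _ "rev n"])
    then obtain n' where n': "ring_walk (\<rho> (min r s) # n' @ [\<rho> (max r s)]) (min r s) (max r s)" "set n' = set n"
      by blast
    have disj: "set m' \<inter> set n' = {}" using less.prems(3) m n m' n' by auto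
    have "min p q < min r s \<and> min r s < max p q \<and> max p q < max r s
        \<or> min r s < min p q \<and> min p q < max r s \<and> max r s < max p q"
      using less.prems(4) ne by (auto simp: min_def max_def)
    then show False
    proof
      assume "min p q < min r s \<and> min r s < max p q \<and> max p q < max r s"
      then show False using no_minimal_crossing[OF _ _ _ _ m'(1) _ n'(1)] m'(2) n'(2) True disj lt by auto
    next
      assume "min r s < min p q \<and> min p q < max r s \<and> max r s < max p q"
      then show False using no_minimal_crossing[OF _ _ _ _ n'(1) _ m'(1)] m'(2) n'(2) True disj lt by auto
    qed
  next
    case False
    then consider t where "t < 7" "\<rho> t \<in> set m" | t where "t < 7" "\<rho> t \<in> set n" by auto
    then show False
    proof cases
      case 1
      then obtain A B where AB: "m = A @ \<rho> t # B" by (meson split_list)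
      have w: "ring_walk (\<rho> p # A @ [\<rho> t]) p t" "ring_walk (\<rho> t # B @ [\<rho> q]) t q"
        using split[of p A t B q] less.prems(1) 1 unfolding m AB by auto
      have "((p < r) \<noteq> (t < r)) \<noteq> ((p < s) \<noteq> (t < s)) \<or> ((t < r) \<noteq> (q < r)) \<noteq> ((t < s) \<noteq> (q < s))"
        using less.prems(4) by blast
      then show False
        using less.hyps[OF _ w(1) less.prems(2)] less.hyps[OF _ w(2) less.prems(2)] less.prems(3)
        unfolding m AB by auto
    next
      case 2
      then obtain A B where AB: "n = A @ \<rho> t # B" by (meson split_list)
      have w: "ring_walk (\<rho> r # A @ [\<rho> t]) r t" "ring_walk (\<rho> t # B @ [\<rho> s]) t s"
        using split[of r A t B s] less.prems(2) 2 unfolding n AB by auto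
      have "((p < r) \<noteq> (q < r)) \<noteq> ((p < t) \<noteq> (q < t)) \<or> ((p < t) \<noteq> (q < t)) \<noteq> ((p < s) \<noteq> (q < s))"
        using less.prems(4) by blast
      then show False
        using less.hyps[OF _ less.prems(1) w(1)] less.hyps[OF _ less.prems(1) w(2)] less.prems(3)
        unfolding n AB by auto
    qed
  qed
qed

lemma ring_noncrossing:
  assumes "conn_on E P" "conn_on E Q" "P \<subseteq> W" "Q \<subseteq> W" "P \<inter> Q = {}"
    and ord: "i < j" "j < k" "k < l" "l < 7" and "\<rho> i \<in> P" "\<rho> k \<in> P" "\<rho> j \<in> Q" "\<rho> l \<in> Q"
  shows False
proof -
  obtain xs where xs: "xs \<noteq> []" "hd xs = \<rho> i" "last xs = \<rho> k" "set xs \<subseteq> P" "successively E xs"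
    using conn_on_walk[OF assms(1,10,11)] by blast
  obtain ys where ys: "ys \<noteq> []" "hd ys = \<rho> j" "last ys = \<rho> l" "set ys \<subseteq> Q" "successively E ys"
    using conn_on_walk[OF assms(2,12,13)] by blast
  show False
  proof (rule no_crossing_walks[of xs i k ys j l])
    show "ring_walk xs i k" "ring_walk ys j l" using xs ys assms by (auto simp: ring_walk_def)
    show "set xs \<inter> set ys = {}" using xs ys assms by blast
  qed (use ord in auto)
qed

end

section \<open>Ring colourings\<close>

text \<open>An enumeration of the four colours, so that letters describe patterns up to
  renaming.\<close>

definition palette :: "nat \<Rightarrow> nat \<Rightarrow> nat \<Rightarrow> nat \<Rightarrow> bool" where
  "palette p q r s \<longleftrightarrow> distinct [p, q, r, s] \<and> p < 4 \<and> q < 4 \<and> r < 4 \<and> s < 4"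

text \<open>A product of two transpositions: one function serves the interchanges in both
  complementary colour pairs.\<close>

definition exchange :: "nat \<Rightarrow> nat \<Rightarrow> nat \<Rightarrow> nat \<Rightarrow> nat \<Rightarrow> nat" where
  "exchange p p' q q' k = (if k = p then p' else if k = p' then p else if k = q then q' else if k = q' then q else k)"

lemma palette_complete:
  assumes "palette p q r s" "k < 4"
  shows "k \<in> {p, q, r, s}"
proof -
  have "card {p, q, r, s} = card {..<4::nat}" "{p, q, r, s} \<subseteq> {..<4}"
    using assms(1) by (auto simp: palette_def)
  then have "{p, q, r, s} = {..<4}" by (metis card_subset_eq finite_lessThan)
  then show ?thesis using assms(2) by blast
qed

lemma palette_extend:
  assumes "p < 4" "q < 4" "r < 4" "distinct [p, q, r]"
  shows "\<exists>s. palette p q r s"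
proof -
  have "card {p, q, r} < card {..<4::nat}" using assms(4) by (simp add: card_insert_if)
  then have "\<not> {..<4} \<subseteq> {p, q, r}" using card_mono[of "{p, q, r}" "{..<4}"] by auto
  then obtain s where "s < 4" "s \<notin> {p, q, r}" by blast
  then show ?thesis using assms by (intro exI[of _ s]) (auto simp: palette_def)
qed

lemma exchange_simps:
  assumes "palette p p' q q'"
  shows "exchange p p' q q' p = p'" "exchange p p' q q' p' = p" "exchange p p' q q' q = q'" "exchange p p' q q' q' = q"
  using assms by (simp_all add: palette_def exchange_def)

lemma
  assumes pal: "palette p p' q q'" and k: "k < 4"
  shows exchange_less: "exchange p p' q q' k < 4"
    and exchange_exchange: "exchange p p' q q' (exchange p p' q q' k) = k"
    and exchange_pair: "exchange p p' q q' k \<in> {p, p'} \<longleftrightarrow> k \<in> {p, p'}"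
proof -
  have "k = p \<or> k = p' \<or> k = q \<or> k = q'" using palette_complete[OF pal k] by simp
  moreover have "p < 4 \<and> p' < 4 \<and> q < 4 \<and> q' < 4" "q \<notin> {p, p'}" "q' \<notin> {p, p'}"
    using pal by (auto simp: palette_def)
  ultimately show "exchange p p' q q' k < 4" "exchange p p' q q' (exchange p p' q q' k) = k"
    "exchange p p' q q' k \<in> {p, p'} \<longleftrightarrow> k \<in> {p, p'}"
    by (metis exchange_simps[OF pal], metis exchange_simps[OF pal], metis exchange_simps[OF pal] insertCI)
qed

lemma exchange_neq:
  assumes "palette p p' q q'" "k < 4" "l < 4" "k \<noteq> l"
  shows "exchange p p' q q' k \<noteq> exchange p p' q q' l"
  using exchange_exchange[OF assms(1,2)] exchange_exchange[OF assms(1,3)] assms(4) by metis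

lemma upt7: "[0..<7] = [0, Suc 0, 2, 3, 4, 5, 6]"
  by (simp add: upt_conv_Cons eval_nat_numeral)

context ring_config
begin

text \<open>The patterns that the graph outside {a, b, d, v1} can show on the ring. A pattern that
  extends to these four vertices is impossible, as the graph has no 4-colouring.\<close>

definition ring_coloring :: "nat list \<Rightarrow> bool" where
  "ring_coloring ks \<longleftrightarrow> (\<exists>\<kappa>. proper E W \<kappa> \<and> map (\<lambda>i. \<kappa> (\<rho> i)) [0..<7] = ks)"

text \<open>\<open>ca\<close>, \<open>cb\<close>, \<open>cd\<close>, \<open>ce\<close> are colours
  for a, b, d, v1; the four exclusions list each edge at these vertices once.\<close>

lemma ring_coloring_not_extendable:
  assumes "ring_coloring [k0, k1, k2, k3, k4, k5, k6]"
    and "ca < 4" "cb < 4" "cd < 4" "ce < 4"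
    and "ca \<notin> {cb, k3, cd, ce, k2}" "cb \<notin> {k3, cd, k4, k5}" "cd \<notin> {ce, k5, k0, k6}" "ce \<notin> {k2, k0, k1}"
  shows False
proof -
  obtain \<kappa> where \<kappa>: "proper E W \<kappa>" "map (\<lambda>i. \<kappa> (\<rho> i)) [0..<7] = [k0, k1, k2, k3, k4, k5, k6]"
    using assms(1) by (auto simp: ring_coloring_def)
  then have k: "\<kappa> y = k0" "\<kappa> z = k1" "\<kappa> v2 = k2" "\<kappa> c = k3" "\<kappa> v4 = k4" "\<kappa> v5 = k5" "\<kappa> x = k6"
    by (simp_all add: upt7)
  let ?c = "\<kappa>(a := ca, b := cb, d := cd, v1 := ce)"
  have out: "?c t = \<kappa> t" if "t \<in> W" for t using that by (auto simp: W_def)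
  have hub: "?c h \<noteq> ?c t" if "h \<in> {a, b, d, v1}" "E h t" for h t
    using that dist k assms(6-9) by (auto simp: edge_iff)
  have "proper E V ?c" unfolding proper_def
  proof (intro conjI ballI impI)
    fix t assume "t \<in> V"
    then show "?c t < 4" using assms(2-5) \<kappa>(1) by (auto simp: proper_def W_def)
  next
    fix s t assume st: "s \<in> V" "t \<in> V" "E s t"
    show "?c s \<noteq> ?c t"
    proof (cases "s \<in> W \<and> t \<in> W")
      case True
      then have "?c s = \<kappa> s" "?c t = \<kappa> t" using out by blast+
      moreover have "\<kappa> s \<noteq> \<kappa> t" using \<kappa>(1) True st(3) by (auto simp: proper_def)
      ultimately show ?thesis by (simp only: not_False_eq_True)
    next
      case False
      then have "s \<in> {a, b, d, v1} \<or> t \<in> {a, b, d, v1}" using st by (auto simp: W_def)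
      then show ?thesis using hub[of s t] hub[of t s] st(3) sgD(5)[OF st(3)] by metis
    qed
  qed
  then show False using not_proper by blast
qed

text \<open>Reduces Kempe arguments to finite checks on ring positions. The clause on consecutive
  positions stops at 5 because x need not be adjacent to v5. The last two clauses are the available
  moves: exchange every position of the opposite pair strictly between two linked positions, or a
  position linked to no other.\<close>

definition kempe_relation :: "nat list \<Rightarrow> nat \<Rightarrow> nat \<Rightarrow> nat \<Rightarrow> nat \<Rightarrow> (nat \<Rightarrow> nat \<Rightarrow> bool) \<Rightarrow> bool" where
  "kempe_relation ks p p' q q' conn \<longleftrightarrow>
    (\<forall>i j. conn i j \<longrightarrow> conn j i) \<and> (\<forall>i j k. conn i j \<longrightarrow> conn j k \<longrightarrow> conn i k) \<and>
    (\<forall>i<7. \<forall>j<7. conn i j \<longrightarrow> (ks ! i \<in> {p, p'} \<longleftrightarrow> ks ! j \<in> {p, p'})) \<and>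
    (\<forall>i<5. (ks ! i \<in> {p, p'} \<longleftrightarrow> ks ! (i + 1) \<in> {p, p'}) \<longrightarrow> conn i (i + 1)) \<and>
    (\<forall>i l. i < l \<longrightarrow> l < 7 \<longrightarrow> conn i l \<longrightarrow>
      ring_coloring (map (\<lambda>t. if i < t \<and> t < l \<and> (ks ! t \<in> {p, p'}) \<noteq> (ks ! i \<in> {p, p'})
        then exchange p p' q q' (ks ! t) else ks ! t) [0..<7])) \<and>
    (\<forall>i<7. (\<forall>j<7. j \<noteq> i \<longrightarrow> \<not> conn i j) \<longrightarrow>
      ring_coloring (map (\<lambda>t. if t = i then exchange p p' q q' (ks ! t) else ks ! t) [0..<7]))"

lemma kempe_relationD:
  assumes "kempe_relation ks p p' q q' conn"
  shows "conn i j \<Longrightarrow> conn j i" "conn i j \<Longrightarrow> conn j k \<Longrightarrow> conn i k"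
    "i < 7 \<Longrightarrow> j < 7 \<Longrightarrow> conn i j \<Longrightarrow> ks ! i \<in> {p, p'} \<longleftrightarrow> ks ! j \<in> {p, p'}"
    "i < 5 \<Longrightarrow> (ks ! i \<in> {p, p'} \<longleftrightarrow> ks ! (i + 1) \<in> {p, p'}) \<Longrightarrow> conn i (i + 1)"
    "i < l \<Longrightarrow> l < 7 \<Longrightarrow> conn i l \<Longrightarrow>
      ring_coloring (map (\<lambda>t. if i < t \<and> t < l \<and> (ks ! t \<in> {p, p'}) \<noteq> (ks ! i \<in> {p, p'})
        then exchange p p' q q' (ks ! t) else ks ! t) [0..<7])"
    "i < 7 \<Longrightarrow> (\<And>j. j < 7 \<Longrightarrow> j \<noteq> i \<Longrightarrow> \<not> conn i j) \<Longrightarrow>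
      ring_coloring (map (\<lambda>t. if t = i then exchange p p' q q' (ks ! t) else ks ! t) [0..<7])"
proof -
  note 1 = assms[unfolded kempe_relation_def]
  note 2 = 1[THEN conjunct2] and 3 = 1[THEN conjunct2, THEN conjunct2]
  note 4 = 3[THEN conjunct2] and 5 = 3[THEN conjunct2, THEN conjunct2]
  show "conn i j \<Longrightarrow> conn j i" by (rule 1[THEN conjunct1, rule_format])
  show "conn i j \<Longrightarrow> conn j k \<Longrightarrow> conn i k" by (rule 2[THEN conjunct1, rule_format])
  show "i < 7 \<Longrightarrow> j < 7 \<Longrightarrow> conn i j \<Longrightarrow> ks ! i \<in> {p, p'} \<longleftrightarrow> ks ! j \<in> {p, p'}"
    by (rule 3[THEN conjunct1, rule_format])
  show "i < 5 \<Longrightarrow> (ks ! i \<in> {p, p'} \<longleftrightarrow> ks ! (i + 1) \<in> {p, p'}) \<Longrightarrow> conn i (i + 1)"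
    by (rule 4[THEN conjunct1, rule_format])
  show "i < l \<Longrightarrow> l < 7 \<Longrightarrow> conn i l \<Longrightarrow>
      ring_coloring (map (\<lambda>t. if i < t \<and> t < l \<and> (ks ! t \<in> {p, p'}) \<noteq> (ks ! i \<in> {p, p'})
        then exchange p p' q q' (ks ! t) else ks ! t) [0..<7])"
    by (rule 5[THEN conjunct1, rule_format])
  show "i < 7 \<Longrightarrow> (\<And>j. j < 7 \<Longrightarrow> j \<noteq> i \<Longrightarrow> \<not> conn i j) \<Longrightarrow>
      ring_coloring (map (\<lambda>t. if t = i then exchange p p' q q' (ks ! t) else ks ! t) [0..<7])"
    by (rule 5[THEN conjunct2, rule_format])
qed

text \<open>Two ring positions are related if they lie in the same Kempe chain for one of the two
  colour pairs. A chain joining positions i and l separates the positions between them from the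
  remaining ones, so the chains of the other pair between i and l can be exchanged.\<close>

lemma kempe_relation_exists:
  assumes ks: "ring_coloring ks" and pal: "palette p p' q q'"
  shows "\<exists>conn. kempe_relation ks p p' q q' conn"
proof -
  obtain \<kappa> where \<kappa>: "proper E W \<kappa>" "map (\<lambda>i. \<kappa> (\<rho> i)) [0..<7] = ks"
    using ks by (auto simp: ring_coloring_def)
  have nth: "ks ! i = \<kappa> (\<rho> i)" if "i < 7" for i using that \<kappa>(2) by auto
  define C where "C v \<longleftrightarrow> \<kappa> v \<in> {p, p'}" for v
  have C: "ks ! i \<in> {p, p'} \<longleftrightarrow> C (\<rho> i)" if "i < 7" for i using nth[OF that] by (simp add: C_def)
  \<comment> \<open>Only edges whose ends have colours in the same pair are kept, so the classes of
    \<open>R\<close> are the Kempe chains of both pairs at once.\<close>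
  define R where "R = (\<lambda>u v. E u v \<and> u \<in> W \<and> v \<in> W \<and> C u = C v)"
  have "symp R" using sgD(5) by (auto simp: symp_def R_def)
  then have sym: "R\<^sup>*\<^sup>* u v \<Longrightarrow> R\<^sup>*\<^sup>* v u" for u v by (metis sympD symp_rtranclp)
  have RC: "C u = C v" if "R\<^sup>*\<^sup>* u v" for u v
    using that by (induction rule: rtranclp_induct) (auto simp: R_def)
  have RW: "v \<in> W" if "R\<^sup>*\<^sup>* u v" "u \<in> W" for u v
    using that by (induction rule: rtranclp_induct) (auto simp: R_def)
  have conn_comp: "conn_on E {v. R\<^sup>*\<^sup>* u v}" for u
  proof (rule conn_onI_root[where r = u])
    let ?S = "{v. R\<^sup>*\<^sup>* u v}"
    fix v assume "v \<in> ?S"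
    then have "R\<^sup>*\<^sup>* u v" by simp
    then show "(induced E ?S)\<^sup>*\<^sup>* u v"
    proof (induction rule: rtranclp_induct)
      case (step s t)
      then have "induced E ?S s t" by (auto simp: induced_def R_def intro: rtranclp.rtrancl_into_rtrancl)
      then show ?case by (rule rtranclp.rtrancl_into_rtrancl[OF step(3)])
    qed simp
  qed (rule sgD(5))
  let ?x = "exchange p p' q q'"
  \<comment> \<open>Any union \<open>X\<close> of chains may be exchanged: an edge within a pair has
    both ends or none in \<open>X\<close>, and an edge across the pairs keeps its ends in different
    pairs.\<close>
  have swap: "ring_coloring (map (\<lambda>t. if t \<in> T then ?x (ks ! t) else ks ! t) [0..<7])"
    if X: "\<And>u v. u \<in> X \<Longrightarrow> R u v \<Longrightarrow> v \<in> X" and T: "\<And>t. t < 7 \<Longrightarrow> \<rho> t \<in> X \<longleftrightarrow> t \<in> T" for X T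
  proof -
    let ?c = "\<lambda>v. if v \<in> X then ?x (\<kappa> v) else \<kappa> v"
    have "proper E W ?c" unfolding proper_def
    proof (intro conjI ballI impI)
      fix v assume "v \<in> W"
      then show "?c v < 4" using \<kappa>(1) exchange_less[OF pal] by (simp add: proper_def)
    next
      fix u v assume uv: "u \<in> W" "v \<in> W" "E u v"
      then have lt: "\<kappa> u < 4" "\<kappa> v < 4" "\<kappa> u \<noteq> \<kappa> v" using \<kappa>(1) by (auto simp: proper_def)
      show "?c u \<noteq> ?c v"
      proof (cases "C u = C v")
        case True
        then have "R u v" "R v u" using uv sgD(5) by (auto simp: R_def)
        then have "u \<in> X \<longleftrightarrow> v \<in> X" using X by blast
        then show ?thesis using lt exchange_neq[OF pal] by simp
      next
        case False
        have "?c w \<in> {p, p'} \<longleftrightarrow> C w" if "\<kappa> w < 4" for w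
          using exchange_pair[OF pal that] by (simp add: C_def)
        then show ?thesis using False lt by metis
      qed
    qed
    moreover have "map (\<lambda>i. ?c (\<rho> i)) [0..<7] = map (\<lambda>t. if t \<in> T then ?x (ks ! t) else ks ! t) [0..<7]"
      using T nth by auto
    ultimately show ?thesis unfolding ring_coloring_def by blast
  qed
  let ?conn = "\<lambda>i j. R\<^sup>*\<^sup>* (\<rho> i) (\<rho> j)"
  have inside: "ring_coloring (map (\<lambda>t. if i < t \<and> t < l \<and> (ks ! t \<in> {p, p'}) \<noteq> (ks ! i \<in> {p, p'})
        then ?x (ks ! t) else ks ! t) [0..<7])" if il: "i < l" "l < 7" "?conn i l" for i l
  proof -
    let ?T = "{t. i < t \<and> t < l \<and> (ks ! t \<in> {p, p'}) \<noteq> (ks ! i \<in> {p, p'})}"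
    let ?X = "{v. \<exists>t\<in>?T. R\<^sup>*\<^sup>* (\<rho> t) v}"
    \<comment> \<open>A chain of the other pair that meets the ring between \<open>i\<close> and
      \<open>l\<close> cannot reach a position outside this interval without crossing the chain that
      joins \<open>i\<close> and \<open>l\<close>.\<close>
    have "u \<in> ?T" if u: "u < 7" "t \<in> ?T" "?conn t u" for u t
    proof -
      have lt: "i < t" "t < l" "t < 7" "i < 7" using u(2) il by simp_all
      have "(ks ! t \<in> {p, p'}) \<noteq> (ks ! i \<in> {p, p'})" using u(2) by blast
      then have "C (\<rho> t) \<noteq> C (\<rho> i)" unfolding C[OF lt(3)] C[OF lt(4)] .
      note t = lt(1-3) this
      have cl: "C (\<rho> u) \<noteq> C (\<rho> i)" using RC[OF u(3)] t(4) by simp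
      then have ne: "u \<noteq> i" "u \<noteq> l" using RC[OF il(3)] by auto
      let ?P = "{v. R\<^sup>*\<^sup>* (\<rho> i) v}" and ?Q = "{v. R\<^sup>*\<^sup>* (\<rho> t) v}"
      have PQ: "?P \<inter> ?Q = {}" using RC t(4) by blast
      have sub: "?P \<subseteq> W" "?Q \<subseteq> W" using RW rho_in_W il t by auto
      have "\<not> l < u"
        using ring_noncrossing[OF conn_comp conn_comp sub PQ, of i t l u] t il u by auto
      moreover have "\<not> u < i"
        using ring_noncrossing[OF conn_comp conn_comp sub(2,1), of u i t l] PQ t il u by auto
      moreover have "(ks ! u \<in> {p, p'}) \<noteq> (ks ! i \<in> {p, p'})" unfolding C[OF u(1)] C[OF lt(4)] by (rule cl)
      ultimately show ?thesis using ne by (intro CollectI conjI) simp_all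
    qed
    then have "\<rho> u \<in> ?X \<longleftrightarrow> u \<in> ?T" if "u < 7" for u using that by blast
    moreover have "v \<in> ?X" if "u \<in> ?X" "R u v" for u v
      using that by (blast intro: rtranclp.rtrancl_into_rtrancl)
    ultimately show ?thesis using swap[of ?X ?T] by simp
  qed
  have single: "ring_coloring (map (\<lambda>t. if t = i then ?x (ks ! t) else ks ! t) [0..<7])"
    if i: "i < 7" "\<And>j. j < 7 \<Longrightarrow> j \<noteq> i \<Longrightarrow> \<not> ?conn i j" for i
  proof -
    let ?X = "{v. R\<^sup>*\<^sup>* (\<rho> i) v}"
    have "\<rho> u \<in> ?X \<longleftrightarrow> u \<in> {i}" if "u < 7" for u using i(2)[OF that] by auto
    moreover have "v \<in> ?X" if "u \<in> ?X" "R u v" for u v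
      using that by (auto intro: rtranclp.rtrancl_into_rtrancl)
    ultimately show ?thesis using swap[of ?X "{i}"] by simp
  qed
  have adjacent: "?conn i (i + 1)" if "i < 5" "ks ! i \<in> {p, p'} \<longleftrightarrow> ks ! (i + 1) \<in> {p, p'}" for i
    using that ring_edge[OF that(1)] rho_in_W[of i] rho_in_W[of "Suc i"] C[of i] C[of "Suc i"]
    by (auto simp: R_def)
  have classes: "ks ! i \<in> {p, p'} \<longleftrightarrow> ks ! j \<in> {p, p'}" if "i < 7" "j < 7" "?conn i j" for i j
    using RC[OF that(3)] C that(1,2) by simp
  show ?thesis
  proof (rule exI[of _ ?conn], unfold kempe_relation_def, intro conjI allI impI)
    fix i j assume "?conn i j"
    then show "?conn j i" by (rule sym)
  next
    fix i j k assume "?conn i j" "?conn j k"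
    then show "?conn i k" by (rule rtranclp_trans)
  next
    fix i j :: nat assume "i < 7" "j < 7" "?conn i j"
    then show "ks ! i \<in> {p, p'} \<longleftrightarrow> ks ! j \<in> {p, p'}" by (rule classes)
  next
    fix i :: nat assume "i < 5" "ks ! i \<in> {p, p'} \<longleftrightarrow> ks ! (i + 1) \<in> {p, p'}"
    then show "?conn i (i + 1)" by (rule adjacent)
  next
    fix i l :: nat assume "i < l" "l < 7" "?conn i l"
    then show "ring_coloring (map (\<lambda>t. if i < t \<and> t < l \<and> (ks ! t \<in> {p, p'}) \<noteq> (ks ! i \<in> {p, p'})
        then ?x (ks ! t) else ks ! t) [0..<7])" by (rule inside)
  next
    fix i :: nat assume "i < 7" "\<forall>j<7. j \<noteq> i \<longrightarrow> \<not> ?conn i j"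
    then show "ring_coloring (map (\<lambda>t. if t = i then ?x (ks ! t) else ks ! t) [0..<7])"
      by (intro single) simp_all
  qed
qed

section \<open>Excluding ring patterns by Kempe interchanges\<close>

text \<open>An intermediate pattern, with p again at position 4. Pairs {p, s} and {q, r}: if 3 is
  linked to 1 or to 5, the p between them becomes s; otherwise 3 is alone and becomes q. All results
  extend.\<close>

lemma not_ring_coloring_pqprprs:
  assumes pal: "palette p q r s"
  shows "\<not> ring_coloring [p, q, p, r, p, r, s]" (is "\<not> ring_coloring ?ks")
proof
  assume "ring_coloring ?ks"
  moreover have "palette p s q r" using pal by (auto simp: palette_def)
  ultimately obtain conn where conn: "kempe_relation ?ks p s q r conn" using kempe_relation_exists by blast
  note K = kempe_relationD[OF conn]
  have d: "distinct [p, q, r, s]" using pal by (simp add: palette_def)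
  have n13: "\<not> conn 1 3"
  proof
    assume "conn 1 3"
    then have "ring_coloring [p, q, s, r, p, r, s]"
      using K(5)[of 1 3] d by (simp add: upt7 exchange_def)
    then show False using ring_coloring_not_extendable[of p q s r p r s p s q r] pal by (auto simp: palette_def)
  qed
  have n35: "\<not> conn 3 5"
  proof
    assume "conn 3 5"
    then have "ring_coloring [p, q, p, r, s, r, s]"
      using K(5)[of 3 5] d by (simp add: upt7 exchange_def)
    then show False using ring_coloring_not_extendable[of p q p r s r s s p q r] pal by (auto simp: palette_def)
  qed
  have "\<not> conn 3 j" if "j < 7" "j \<noteq> 3" for j
    using that K(3)[of 3 j] d n13 n35 K(1)[of 3 1] by (auto simp: less7)
  then have "ring_coloring [p, q, p, q, p, r, s]"
    using K(6)[of 3] d by (simp add: upt7 exchange_def)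
  then show False using ring_coloring_not_extendable[of p q p q p r s r s q s] pal by (auto simp: palette_def)
qed

text \<open>Pairs {p, r} and {q, s}: if 0 is linked to 2, the q at 1 becomes s; if it is linked to 4
  only, then 2 is alone and becomes r; otherwise 0 is alone and becomes r. All results
  extend.\<close>

lemma not_ring_coloring_pqpqrqs:
  assumes pal: "palette p q r s"
  shows "\<not> ring_coloring [p, q, p, q, r, q, s]" (is "\<not> ring_coloring ?ks")
proof
  assume "ring_coloring ?ks"
  moreover have "palette p r q s" using pal by (auto simp: palette_def)
  ultimately obtain conn where conn: "kempe_relation ?ks p r q s conn" using kempe_relation_exists by blast
  note K = kempe_relationD[OF conn]
  have d: "distinct [p, q, r, s]" using pal by (simp add: palette_def)
  have n02: "\<not> conn 0 2"
  proof
    assume "conn 0 2"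
    then have "ring_coloring [p, s, p, q, r, q, s]"
      using K(5)[of 0 2] d by (simp add: upt7 exchange_def)
    then show False using ring_coloring_not_extendable[of p s p q r q s s p r q] pal by (auto simp: palette_def)
  qed
  have n04: "\<not> conn 0 4"
  proof
    assume c: "conn 0 4"
    have "\<not> conn 2 j" if "j < 7" "j \<noteq> 2" for j
      using that K(3)[of 2 j] c d n02 K(1)[of 2 0] K(2)[of 0 4 2] K(1)[of 2 4] by (auto simp: less7)
    then have "ring_coloring [p, q, r, q, r, q, s]"
      using K(6)[of 2] d by (simp add: upt7 exchange_def)
    then show False using ring_coloring_not_extendable[of p q r q r q s p s r s] pal by (auto simp: palette_def)
  qed
  have "\<not> conn 0 j" if "j < 7" "j \<noteq> 0" for j
    using that K(3)[of 0 j] d n02 n04 by (auto simp: less7)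
  then have "ring_coloring [r, q, p, q, r, q, s]"
    using K(6)[of 0] d by (simp add: upt7 exchange_def)
  then show False using ring_coloring_not_extendable[of r q p q r q s r s p s] pal by (auto simp: palette_def)
qed

text \<open>The pairs and cases of \<open>not_ring_coloring_pqpqrqs\<close>; only the colour of x
  and with it the extensions differ.\<close>

lemma not_ring_coloring_pqpqrqq:
  assumes pal: "palette p q r s"
  shows "\<not> ring_coloring [p, q, p, q, r, q, q]" (is "\<not> ring_coloring ?ks")
proof
  assume "ring_coloring ?ks"
  moreover have "palette p r q s" using pal by (auto simp: palette_def)
  ultimately obtain conn where conn: "kempe_relation ?ks p r q s conn" using kempe_relation_exists by blast
  note K = kempe_relationD[OF conn]
  have d: "distinct [p, q, r, s]" using pal by (simp add: palette_def)
  have n02: "\<not> conn 0 2"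
  proof
    assume "conn 0 2"
    then have "ring_coloring [p, s, p, q, r, q, q]"
      using K(5)[of 0 2] d by (simp add: upt7 exchange_def)
    then show False using ring_coloring_not_extendable[of p s p q r q q r p s q] pal by (auto simp: palette_def)
  qed
  have n04: "\<not> conn 0 4"
  proof
    assume c: "conn 0 4"
    have "\<not> conn 2 j" if "j < 7" "j \<noteq> 2" for j
      using that K(3)[of 2 j] c d n02 K(1)[of 2 0] K(2)[of 0 4 2] K(1)[of 2 4] by (auto simp: less7)
    then have "ring_coloring [p, q, r, q, r, q, q]"
      using K(6)[of 2] d by (simp add: upt7 exchange_def)
    then show False using ring_coloring_not_extendable[of p q r q r q q p s r s] pal by (auto simp: palette_def)
  qed
  have "\<not> conn 0 j" if "j < 7" "j \<noteq> 0" for j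
    using that K(3)[of 0 j] d n02 n04 by (auto simp: less7)
  then have "ring_coloring [r, q, p, q, r, q, q]"
    using K(6)[of 0] d by (simp add: upt7 exchange_def)
  then show False using ring_coloring_not_extendable[of r q p q r q q r s p s] pal by (auto simp: palette_def)
qed

text \<open>Pairs {p, q} and {r, s}: positions 0 to 3 lie in one chain. If it reaches 5, the r at 4
  becomes s, which is \<open>pqpqrqs\<close> with r and s renamed; otherwise 5 is alone, becomes p,
  and the pattern extends.\<close>

lemma not_ring_coloring_pqpqrqr:
  assumes pal: "palette p q r s"
  shows "\<not> ring_coloring [p, q, p, q, r, q, r]" (is "\<not> ring_coloring ?ks")
proof
  assume "ring_coloring ?ks"
  moreover have "palette p q r s" using pal by (auto simp: palette_def)
  ultimately obtain conn where conn: "kempe_relation ?ks p q r s conn" using kempe_relation_exists by blast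
  note K = kempe_relationD[OF conn]
  have d: "distinct [p, q, r, s]" using pal by (simp add: palette_def)
  have ring: "conn 0 1" "conn 1 2" "conn 2 3"
    using K(4)[of 0] K(4)[of 1] K(4)[of 2] by (simp_all add: eval_nat_numeral)
  have n05: "\<not> conn 0 5"
  proof
    assume "conn 0 5"
    then have "ring_coloring [p, q, p, q, s, q, r]"
      using K(5)[of 0 5] d by (simp add: upt7 exchange_def)
    then show False using not_ring_coloring_pqpqrqs[of p q s r] pal by (auto simp: palette_def)
  qed
  have "\<not> conn 5 j" if "j < 7" "j \<noteq> 5" for j
    using that K(3)[of 5 j] d n05 ring K(1)[of 5 0] K(1)[of 5 1] K(1)[of 5 2] K(1)[of 5 3] K(2)[of 0 1 5] K(2)[of 1 2 5] K(2)[of 2 3 5] by (auto simp: less7)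
  then have "ring_coloring [p, q, p, q, r, p, r]"
    using K(6)[of 5] d by (simp add: upt7 exchange_def)
  then show False using ring_coloring_not_extendable[of p q p q r p r r s q s] pal by (auto simp: palette_def)
qed

text \<open>Intermediate. Pairs {p, q} and {r, s}: if the chain of 0, 1, 2 reaches 4, the r at 3
  becomes s, a renamed \<open>pqprprs\<close>; otherwise 4 becomes q and the pattern
  extends.\<close>

lemma not_ring_coloring_pqprpsr:
  assumes pal: "palette p q r s"
  shows "\<not> ring_coloring [p, q, p, r, p, s, r]" (is "\<not> ring_coloring ?ks")
proof
  assume "ring_coloring ?ks"
  moreover have "palette p q r s" using pal by (auto simp: palette_def)
  ultimately obtain conn where conn: "kempe_relation ?ks p q r s conn" using kempe_relation_exists by blast
  note K = kempe_relationD[OF conn]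
  have d: "distinct [p, q, r, s]" using pal by (simp add: palette_def)
  have ring: "conn 0 1" "conn 1 2"
    using K(4)[of 0] K(4)[of 1] by (simp_all add: eval_nat_numeral)
  have n04: "\<not> conn 0 4"
  proof
    assume "conn 0 4"
    then have "ring_coloring [p, q, p, s, p, s, r]"
      using K(5)[of 0 4] d by (simp add: upt7 exchange_def)
    then show False using not_ring_coloring_pqprprs[of p q s r] pal by (auto simp: palette_def)
  qed
  have "\<not> conn 4 j" if "j < 7" "j \<noteq> 4" for j
    using that K(3)[of 4 j] d n04 ring K(1)[of 4 0] K(1)[of 4 1] K(1)[of 4 2] K(2)[of 0 1 4] K(2)[of 1 2 4] by (auto simp: less7)
  then have "ring_coloring [p, q, p, r, q, s, r]"
    using K(6)[of 4] d by (simp add: upt7 exchange_def)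
  then show False using ring_coloring_not_extendable[of p q p r q s r s p q r] pal by (auto simp: palette_def)
qed

text \<open>Intermediate. Pairs {p, r} and {q, s}: if 0 is linked to 2, the q at 1 becomes s, a
  renamed \<open>pqprpsr\<close>; if it is linked to 4, and so to 5, the q at 1 and 3 become s;
  otherwise 0 becomes r. The last two extend.\<close>

lemma not_ring_coloring_pqpqprq:
  assumes pal: "palette p q r s"
  shows "\<not> ring_coloring [p, q, p, q, p, r, q]" (is "\<not> ring_coloring ?ks")
proof
  assume "ring_coloring ?ks"
  moreover have "palette p r q s" using pal by (auto simp: palette_def)
  ultimately obtain conn where conn: "kempe_relation ?ks p r q s conn" using kempe_relation_exists by blast
  note K = kempe_relationD[OF conn]
  have d: "distinct [p, q, r, s]" using pal by (simp add: palette_def)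
  have ring: "conn 4 5"
    using K(4)[of 4] by (simp_all add: eval_nat_numeral)
  have n02: "\<not> conn 0 2"
  proof
    assume "conn 0 2"
    then have "ring_coloring [p, s, p, q, p, r, q]"
      using K(5)[of 0 2] d by (simp add: upt7 exchange_def)
    then show False using not_ring_coloring_pqprpsr[of p s q r] pal by (auto simp: palette_def)
  qed
  have n04: "\<not> conn 0 4"
  proof
    assume "conn 0 4"
    then have "ring_coloring [p, s, p, s, p, r, q]"
      using K(5)[of 0 4] d by (simp add: upt7 exchange_def)
    then show False using ring_coloring_not_extendable[of p s p s p r q r q s q] pal by (auto simp: palette_def)
  qed
  have "\<not> conn 0 j" if "j < 7" "j \<noteq> 0" for j
    using that K(3)[of 0 j] d n02 n04 ring K(1)[of 4 5] K(2)[of 0 5 4] by (auto simp: less7)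
  then have "ring_coloring [r, q, p, q, p, r, q]"
    using K(6)[of 0] d by (simp add: upt7 exchange_def)
  then show False using ring_coloring_not_extendable[of r q p q p r q r s p s] pal by (auto simp: palette_def)
qed

text \<open>The longest descent. Pairs {p, r} and {q, s}: if 4 is linked to 0, the q at 1 and 3
  become s, a renamed \<open>pqpqrqs\<close>; if it is linked to 2, only the q at 3 does and the
  pattern extends; otherwise 4 becomes p, a renamed \<open>pqpqprq\<close>, which takes up to three
  more rounds.\<close>

lemma not_ring_coloring_pqpqrsq:
  assumes pal: "palette p q r s"
  shows "\<not> ring_coloring [p, q, p, q, r, s, q]" (is "\<not> ring_coloring ?ks")
proof
  assume "ring_coloring ?ks"
  moreover have "palette p r q s" using pal by (auto simp: palette_def)
  ultimately obtain conn where conn: "kempe_relation ?ks p r q s conn" using kempe_relation_exists by blast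
  note K = kempe_relationD[OF conn]
  have d: "distinct [p, q, r, s]" using pal by (simp add: palette_def)
  have n04: "\<not> conn 0 4"
  proof
    assume "conn 0 4"
    then have "ring_coloring [p, s, p, s, r, s, q]"
      using K(5)[of 0 4] d by (simp add: upt7 exchange_def)
    then show False using not_ring_coloring_pqpqrqs[of p s r q] pal by (auto simp: palette_def)
  qed
  have n24: "\<not> conn 2 4"
  proof
    assume "conn 2 4"
    then have "ring_coloring [p, q, p, s, r, s, q]"
      using K(5)[of 2 4] d by (simp add: upt7 exchange_def)
    then show False using ring_coloring_not_extendable[of p q p s r s q q p r s] pal by (auto simp: palette_def)
  qed
  have "\<not> conn 4 j" if "j < 7" "j \<noteq> 4" for j
    using that K(3)[of 4 j] d n04 n24 K(1)[of 4 0] K(1)[of 4 2] by (auto simp: less7)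
  then have "ring_coloring [p, q, p, q, p, s, q]"
    using K(6)[of 4] d by (simp add: upt7 exchange_def)
  then show False using not_ring_coloring_pqpqprq[of p q s r] pal by (auto simp: palette_def)
qed

section \<open>The initial pattern and the contradiction\<close>

text \<open>The contracted set is connected through a and d, and as y and v2 are nonadjacent, both
  may keep its colour \<open>p\<close>. Every other ring vertex is adjacent to the set: z to y, c to
  a, v4 and v5 to b, x to d.\<close>

lemma initial_ring_coloring:
  "\<exists>p k1 k3 k4 k5 k6. ring_coloring [p, k1, p, k3, k4, k5, k6] \<and> p < 4 \<and> k1 < 4 \<and> k3 < 4 \<and> k4 < 4 \<and> k5 < 4 \<and> k6 < 4
    \<and> p \<notin> {k1, k3, k4, k5, k6} \<and> k3 \<noteq> k4 \<and> k4 \<noteq> k5"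
proof -
  let ?S = "{a, b, d, v2, y}"
  have "conn_on E (insert a {b, d, v2})" by (intro conn_star) (auto simp: edge_iff)
  moreover have "E y d" using edge_iff(3)[of y] sgD(5) by blast
  ultimately have "conn_on E (insert y (insert a {b, d, v2}))"
    using conn_insert[of "insert a {b, d, v2}" d y] by blast
  moreover have "insert y (insert a {b, d, v2}) = ?S" by auto
  ultimately have S: "conn_on E ?S" by simp
  have W: "\<rho> t \<in> V" if "t < 7" for t using rho_in_W[OF that] by (simp add: W_def)
  have V: "y \<in> V" "z \<in> V" "v2 \<in> V" "c \<in> V" "v4 \<in> V" "v5 \<in> V" "x \<in> V"
    using W[of 0] W[of "Suc 0"] W[of 2] W[of 3] W[of 4] W[of 5] W[of 6] by simp_all
  have hubV: "a \<in> V" "b \<in> V" "d \<in> V" using edge_iff(1)[of b] edge_iff(1)[of d] sgD(2,3) by blast+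
  have "?S \<subseteq> V" using V hubV by simp
  moreover have "a \<noteq> b" using dist by simp
  ultimately obtain \<kappa> where \<kappa>: "\<And>t. t \<in> V \<Longrightarrow> \<kappa> t < 4"
    "\<And>s t. s \<in> V \<Longrightarrow> t \<in> V \<Longrightarrow> E s t \<Longrightarrow> \<not> (s \<in> ?S \<and> t \<in> ?S) \<Longrightarrow> \<kappa> s \<noteq> \<kappa> t"
    "\<And>t. t \<in> ?S \<Longrightarrow> \<kappa> t = (\<kappa> a :: nat)"
    using contract_coloring[of ?S V a b] S by auto
  have "proper E W \<kappa>" unfolding proper_def
  proof (intro conjI ballI impI)
    fix s t assume st: "s \<in> W" "t \<in> W" "E s t"
    have "\<not> (s \<in> ?S \<and> t \<in> ?S)"
    proof
      assume "s \<in> ?S \<and> t \<in> ?S"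
      then have "s \<in> {v2, y}" "t \<in> {v2, y}" using st by (auto simp: W_def)
      then show False using st(3) chord sgD(5)[OF st(3)] sgD(6) by auto
    qed
    then show "\<kappa> s \<noteq> \<kappa> t" using \<kappa>(2) st by (simp add: W_def)
  qed (use \<kappa>(1) in \<open>auto simp: W_def\<close>)
  moreover have "map (\<lambda>i. \<kappa> (\<rho> i)) [0..<7] = [\<kappa> a, \<kappa> z, \<kappa> a, \<kappa> c, \<kappa> v4, \<kappa> v5, \<kappa> x]"
    using \<kappa>(3)[of y] \<kappa>(3)[of v2] by (simp add: upt7)
  ultimately have "ring_coloring [\<kappa> a, \<kappa> z, \<kappa> a, \<kappa> c, \<kappa> v4, \<kappa> v5, \<kappa> x]"
    unfolding ring_coloring_def by (intro exI[of _ \<kappa>] conjI)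
  moreover have "\<kappa> a \<noteq> \<kappa> t" if "t \<in> {z, c, v4, v5, x}" for t
  proof -
    have "\<exists>s\<in>?S. E s t" using that edge_iff ring(1) by auto
    then obtain s where "s \<in> ?S" "E s t" by blast
    moreover have "t \<notin> ?S" using that dist by auto
    ultimately have "\<kappa> s \<noteq> \<kappa> t" using \<kappa>(2)[of s t] sgD(2,3) by blast
    then show ?thesis using \<kappa>(3)[OF \<open>s \<in> ?S\<close>] by simp
  qed
  then have "\<kappa> a \<notin> {\<kappa> z, \<kappa> c, \<kappa> v4, \<kappa> v5, \<kappa> x}" by blast
  moreover have "\<kappa> c \<noteq> \<kappa> v4" "\<kappa> v4 \<noteq> \<kappa> v5" using \<kappa>(2) ring V dist by auto
  ultimately show ?thesis using \<kappa>(1) V hubV by blast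
qed

lemma no_ring_config: False
proof -
  obtain p q k3 k4 k5 k6 where k: "ring_coloring [p, q, p, k3, k4, k5, k6]"
    "p < 4" "q < 4" "k3 < 4" "k4 < 4" "k5 < 4" "k6 < 4"
    "p \<notin> {q, k3, k4, k5, k6}" "k3 \<noteq> k4" "k4 \<noteq> k5"
    using initial_ring_coloring by blast
  \<comment> \<open>Colours are named by first appearance: \<open>r\<close> is the first of
    \<open>k3\<close>, \<open>k4\<close> other than \<open>q\<close>. Either \<open>k3 = q\<close>
    and \<open>k4 = r\<close>, with 2 * 3 choices for \<open>k5\<close>, \<open>k6\<close>, or
    \<open>k3 = r\<close>, with 2 * 2 * 3 choices for the rest: 18 patterns.\<close>
  define r where "r = (if k3 = q then k4 else k3)"
  have "r < 4" "distinct [p, q, r]" using k by (auto simp: r_def)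
  then obtain s where pal: "palette p q r s" using palette_extend[OF k(2,3)] by blast
  have in_pal: "k3 \<in> {q, r, s}" "k4 \<in> {q, r, s}" "k5 \<in> {q, r, s}" "k6 \<in> {q, r, s}"
    using palette_complete[OF pal] k by auto
  have r: "k3 = q \<and> k4 = r \<or> k3 = r" by (auto simp: r_def)
  have "\<not> ring_coloring [p, q, p, q, r, q, q]" by (rule not_ring_coloring_pqpqrqq[OF pal])
  moreover have "\<not> ring_coloring [p, q, p, q, r, q, r]" by (rule not_ring_coloring_pqpqrqr[OF pal])
  moreover have "\<not> ring_coloring [p, q, p, q, r, q, s]" by (rule not_ring_coloring_pqpqrqs[OF pal])
  moreover have "\<not> ring_coloring [p, q, p, q, r, s, q]" by (rule not_ring_coloring_pqpqrsq[OF pal])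
  moreover have "\<not> ring_coloring [p, q, p, q, r, s, r]" using ring_coloring_not_extendable[of p q p q r s r r p q s] pal by (auto simp: palette_def)
  moreover have "\<not> ring_coloring [p, q, p, q, r, s, s]" using ring_coloring_not_extendable[of p q p q r s s r p q s] pal by (auto simp: palette_def)
  moreover have "\<not> ring_coloring [p, q, p, r, q, r, q]" using ring_coloring_not_extendable[of p q p r q r q q p s r] pal by (auto simp: palette_def)
  moreover have "\<not> ring_coloring [p, q, p, r, q, r, r]" using ring_coloring_not_extendable[of p q p r q r r q p s r] pal by (auto simp: palette_def)
  moreover have "\<not> ring_coloring [p, q, p, r, q, r, s]" using ring_coloring_not_extendable[of p q p r q r s s p q r] pal by (auto simp: palette_def)
  moreover have "\<not> ring_coloring [p, q, p, r, q, s, q]" using ring_coloring_not_extendable[of p q p r q s q q p r s] pal by (auto simp: palette_def)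
  moreover have "\<not> ring_coloring [p, q, p, r, q, s, r]" using ring_coloring_not_extendable[of p q p r q s r s p q r] pal by (auto simp: palette_def)
  moreover have "\<not> ring_coloring [p, q, p, r, q, s, s]" using ring_coloring_not_extendable[of p q p r q s s q p r s] pal by (auto simp: palette_def)
  moreover have "\<not> ring_coloring [p, q, p, r, s, q, q]" using ring_coloring_not_extendable[of p q p r s q q q p r s] pal by (auto simp: palette_def)
  moreover have "\<not> ring_coloring [p, q, p, r, s, q, r]" using ring_coloring_not_extendable[of p q p r s q r q p s r] pal by (auto simp: palette_def)
  moreover have "\<not> ring_coloring [p, q, p, r, s, q, s]" using ring_coloring_not_extendable[of p q p r s q s q p r s] pal by (auto simp: palette_def)
  moreover have "\<not> ring_coloring [p, q, p, r, s, r, q]" using ring_coloring_not_extendable[of p q p r s r q q p s r] pal by (auto simp: palette_def)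
  moreover have "\<not> ring_coloring [p, q, p, r, s, r, r]" using ring_coloring_not_extendable[of p q p r s r r q p s r] pal by (auto simp: palette_def)
  moreover have "\<not> ring_coloring [p, q, p, r, s, r, s]" using ring_coloring_not_extendable[of p q p r s r s s p q r] pal by (auto simp: palette_def)
  ultimately show False using k(1,9,10) in_pal r by auto
qed

end

theorem theorem3p6:
  fixes V :: "'a set" and E :: "'a \<Rightarrow> 'a \<Rightarrow> bool"
    and a b c d v1 v2 v3 v4 v5 :: 'a
  assumes "eMPGN4 V E"
    and "{a, b, c, d, v1, v2, v3, v4, v5} \<subseteq> V"
    and "distinct [a, b, c, d, v1, v2, v3, v4, v5]"
    and "nbrs E a = {b, c, d, v1, v2}"
    and "nbrs E b = {a, c, d, v4, v5}"
    and "nbrs E c = {a, b, v2, v3, v4}"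
  shows "\<not> (deg E v1 = 5 \<and> deg E d = 6)"
proof
  assume "deg E v1 = 5 \<and> deg E d = 6"
  then have "card (nbrs E d) = 6" "card (nbrs E v1) = 5" by (auto simp: deg_def)
  then obtain y z x where "ring_config V E a b d v1 y z v2 c v4 v5 x"
    using min_noncolorable.ring_config_exists[OF eMPGN4_min_noncolorable[OF assms(1)] assms(3-6)] by blast
  then show False by (rule ring_config.no_ring_config)
qed

end
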